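(* Let $G_0$ be a snark, let $u_1,\dots,u_5$ be distinct vertices of $G_0$ such that $(u_1,u_2),(u_2,u_3),(u_3,u_4),(u_4,u_5)$ are edges of $G_0$, and let $v_2,v_3,v_4$ be vertices of $G_0$, distinct from the $u_m$'s, such that $(u_2,v_2),(u_3,v_3),(u_4,v_4)$ are edges of $G_0$. Let $G$ be the graph (a snark) obtained from $G_0$ and these vertices by superposition. Let $F$ be an edge of $G_0$ other than one of the seven edges $(u_m,u_{m+1})$, $m\in\{1,2,3,4\}$, or $(u_m,v_m)$, $m\in\{2,3,4\}$ (so that $F$ is also an edge of $G$). Then $\psi(G,F) = 5\cdot\psi(G_0,F)$.
   Context: All graphs are undirected. A graph is simple if it is connected, has finitely many vertices, and has no loops or multiple edges; it is cubic if each vertex is attached to exactly 3 edges. A 3-edge-colouring assigns one of three colours to each edge so that no two adjacent edges receive the same colour. A 3-edge-decomposition is a partition of the edges into three (unordered) classes such that no two adjacent edges are in the same class. A snark is a simple cubic graph that is not 3-edge-colourable, has girth at least 5, and is at least cyclically 4-edge-connected (i.e. any two vertex-disjoint cycles are joined by 4 mutually edge-disjoint paths). Edge subtraction: given an edge $e=(u,v)$ of a cubic graph $G$, remove $e$; this leaves divalent vertices $u$ and $v$, with edges $(u,p_1),(u,p_2),(v,q_1),(v,q_2)$. Delete $u$ and $v$ and these edges, and form new edges $(p_1,p_2)$ and $(q_1,q_2)$. The resulting cubic graph is $G_e$. The number $\psi(G,e)$: for $G$ a simple, non-3-edge-colourable cubic graph and $e$ an edge of $G$, it is known that the number of 3-edge-decompositions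 of $G_e$ equals $3J$ for some nonnegative integer $J$ (possibly $0$); define $\psi(G,e) := J$. Equivalently, the number of 3-edge-colourings of $G_e$ (with a fixed set of three colours) is $18\,\psi(G,e)$. Superposition. Let $T$ be the graph (built from two Petersen graphs) with the 19 vertices $a,b,c,d,e,f,g,h,i,j,k,s_1,s_2,s_3,s_4,t_1,t_2,t_3,t_4$ and the 26 edges $(b,h),(h,c),(c,i),(i,d)$; $(a,f),(f,k),(k,e)$; $(g,j)$; $(b,s_1),(h,s_2),(a,s_3),(f,s_4)$; $(s_1,s_4),(s_4,s_2),(s_2,s_3),(s_3,g),(g,s_1)$; $(i,t_1),(d,t_2),(e,t_3),(k,t_4)$; $(j,t_3),(t_3,t_1),(t_1,t_4),(t_4,t_2),(t_2,j)$. The vertices $a,b,c,d,e$ are 2-valent in $T$; all others are 3-valent. Given a snark $G_0$ (disjoint from $T$) and vertices $u_1,\dots,u_5,v_2,v_3,v_4$ of $G_0$ as in the claim, the superposition $G$ is the cubic graph obtained from the disjoint union of $G_0$ and $T$ by deleting the vertices $u_2,u_3,u_4$ together with all edges attached to them (namely $(u_1,u_2),(u_2,u_3),(u_3,u_4),(u_4,u_5),(u_2,v_2),(u_3,v_3),(u_4,v_4)$), and inserting the five new edges $(u_1,a),(v_2,b),(v_3,c),(v_4,d),(u_5,e)$. It is known that $G$ is a snark. *)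

theory Defs
  imports Main "HOL-Library.Disjoint_Sets"
begin

section \<open>Undirected multigraphs\<close>

text \<open>Edges carry identities and \<open>ends\<close> gives the set of end vertices of an edge, which is a
  singleton for a loop. Multiple edges have to be representable because subtracting an edge from a
  simple cubic graph may create parallel edges.\<close>

record ('v, 'e) ugraph =
  verts :: "'v set"
  edges :: "'e set"
  ends :: "'e \<Rightarrow> 'v set"

definition graph :: "('v, 'e) ugraph \<Rightarrow> bool" where
  "graph G \<longleftrightarrow> (\<forall>e\<in>edges G. ends G e \<subseteq> verts G \<and> (card (ends G e) = 1 \<or> card (ends G e) = 2))"

definition joined :: "('v, 'e) ugraph \<Rightarrow> 'v \<Rightarrow> 'v \<Rightarrow> bool" where
  "joined G u v \<longleftrightarrow> (\<exists>e\<in>edges G. ends G e = {u, v})"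

definition adjacent_edges :: "('v, 'e) ugraph \<Rightarrow> 'e \<Rightarrow> 'e \<Rightarrow> bool" where
  "adjacent_edges G e f \<longleftrightarrow> e \<noteq> f \<and> ends G e \<inter> ends G f \<noteq> {}"

definition path :: "('v, 'e) ugraph \<Rightarrow> 'v list \<Rightarrow> 'e list \<Rightarrow> bool" where
  "path G vs es \<longleftrightarrow>
     length vs = Suc (length es) \<and> distinct vs \<and> set vs \<subseteq> verts G \<and> set es \<subseteq> edges G \<and>
     (\<forall>i<length es. ends G (es ! i) = {vs ! i, vs ! Suc i})"

text \<open>A loop is a cycle of length 1; two parallel edges form a cycle of length 2, which is why the
  edges are required to be distinct, too.\<close>

definition cycle :: "('v, 'e) ugraph \<Rightarrow> 'v list \<Rightarrow> 'e list \<Rightarrow> bool" where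
  "cycle G vs es \<longleftrightarrow>
     es \<noteq> [] \<and> length vs = length es \<and> distinct vs \<and> distinct es \<and>
     set vs \<subseteq> verts G \<and> set es \<subseteq> edges G \<and>
     (\<forall>i<length es. ends G (es ! i) = {vs ! i, vs ! (Suc i mod length es)})"

definition connected_graph :: "('v, 'e) ugraph \<Rightarrow> bool" where
  "connected_graph G \<longleftrightarrow> verts G \<noteq> {} \<and>
     (\<forall>u\<in>verts G. \<forall>v\<in>verts G. \<exists>vs es. path G vs es \<and> hd vs = u \<and> last vs = v)"

definition simple :: "('v, 'e) ugraph \<Rightarrow> bool" where
  "simple G \<longleftrightarrow> graph G \<and> connected_graph G \<and> finite (verts G) \<and>
     (\<forall>e\<in>edges G. card (ends G e) \<noteq> 1) \<and> inj_on (ends G) (edges G)"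

text \<open>The second summand makes loops count twice.\<close>

definition degree :: "('v, 'e) ugraph \<Rightarrow> 'v \<Rightarrow> nat" where
  "degree G v = card {e \<in> edges G. v \<in> ends G e} + card {e \<in> edges G. ends G e = {v}}"

definition cubic :: "('v, 'e) ugraph \<Rightarrow> bool" where
  "cubic G \<longleftrightarrow> (\<forall>v\<in>verts G. degree G v = 3)"


section \<open>Colourings, decompositions and snarks\<close>

definition edge_colouring3 :: "('v, 'e) ugraph \<Rightarrow> ('e \<Rightarrow> nat) \<Rightarrow> bool" where
  "edge_colouring3 G c \<longleftrightarrow> (\<forall>e\<in>edges G. c e < 3) \<and>
     (\<forall>e\<in>edges G. \<forall>f\<in>edges G. adjacent_edges G e f \<longrightarrow> c e \<noteq> c f)"

definition edge_colourable3 :: "('v, 'e) ugraph \<Rightarrow> bool" where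
  "edge_colourable3 G \<longleftrightarrow> (\<exists>c. edge_colouring3 G c)"

text \<open>The classes of \<open>partition_on\<close> are nonempty. In a nonempty loopless cubic graph this is no
  restriction, since the three edges at any vertex lie in three different classes.\<close>

definition edge_decompositions3 :: "('v, 'e) ugraph \<Rightarrow> 'e set set set" where
  "edge_decompositions3 G = {P. partition_on (edges G) P \<and> card P = 3 \<and>
     (\<forall>X\<in>P. \<forall>e\<in>X. \<forall>f\<in>X. \<not> adjacent_edges G e f)}"

definition girth_at_least :: "('v, 'e) ugraph \<Rightarrow> nat \<Rightarrow> bool" where
  "girth_at_least G n \<longleftrightarrow> (\<forall>vs es. cycle G vs es \<longrightarrow> n \<le> length es)"

definition cyclically_edge_connected :: "('v, 'e) ugraph \<Rightarrow> nat \<Rightarrow> bool" where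
  "cyclically_edge_connected G n \<longleftrightarrow>
     (\<forall>vs es ws fs. cycle G vs es \<and> cycle G ws fs \<and> set vs \<inter> set ws = {} \<longrightarrow>
       (\<exists>pv pe. (\<forall>i<n. path G (pv i) (pe i) \<and> hd (pv i) \<in> set vs \<and> last (pv i) \<in> set ws) \<and>
                (\<forall>i<n. \<forall>j<n. i \<noteq> j \<longrightarrow> set (pe i) \<inter> set (pe j) = {})))"

definition snark :: "('v, 'e) ugraph \<Rightarrow> bool" where
  "snark G \<longleftrightarrow> simple G \<and> cubic G \<and> \<not> edge_colourable3 G \<and>
     girth_at_least G 5 \<and> cyclically_edge_connected G 4"


section \<open>Edge subtraction\<close>

text \<open>\<open>Merged w\<close> is the new edge that replaces the end \<open>w\<close> of the subtracted edge \<open>e\<close>. If the graph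
  is simple and cubic, then its set of ends below consists of exactly the two neighbours of \<open>w\<close> other
  than the opposite end of \<open>e\<close>.\<close>

datatype ('v, 'e) sub_edge = Kept 'e | Merged 'v

definition subtract_edge :: "('v, 'e) ugraph \<Rightarrow> 'e \<Rightarrow> ('v, ('v, 'e) sub_edge) ugraph" where
  "subtract_edge G e =
     \<lparr>verts = verts G - ends G e,
      edges = Kept ` {f \<in> edges G. ends G f \<inter> ends G e = {}} \<union> Merged ` ends G e,
      ends = (\<lambda>x. case x of
                Kept f \<Rightarrow> ends G f
              | Merged w \<Rightarrow> {p. \<exists>f\<in>edges G - {e}. ends G f = {w, p}})\<rparr>"

text \<open>Meaningful if \<open>G\<close> is simple, cubic and not 3-edge-colourable and \<open>e\<close> is an edge of \<open>G\<close>: then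
  the number of decompositions is a multiple of 3.\<close>

definition psi :: "('v, 'e) ugraph \<Rightarrow> 'e \<Rightarrow> nat" where
  "psi G e = (THE J. card (edge_decompositions3 (subtract_edge G e)) = 3 * J)"


section \<open>Superposition\<close>

datatype tvert = Ta | Tb | Tc | Td | Te | Tf | Tg | Th | Ti | Tj | Tk
  | Ts1 | Ts2 | Ts3 | Ts4 | Tt1 | Tt2 | Tt3 | Tt4

definition T_edges :: "tvert set set" where
  "T_edges =
     {{Tb, Th}, {Th, Tc}, {Tc, Ti}, {Ti, Td},
      {Ta, Tf}, {Tf, Tk}, {Tk, Te},
      {Tg, Tj},
      {Tb, Ts1}, {Th, Ts2}, {Ta, Ts3}, {Tf, Ts4},
      {Ts1, Ts4}, {Ts4, Ts2}, {Ts2, Ts3}, {Ts3, Tg}, {Tg, Ts1},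
      {Ti, Tt1}, {Td, Tt2}, {Te, Tt3}, {Tk, Tt4},
      {Tj, Tt3}, {Tt3, Tt1}, {Tt1, Tt4}, {Tt4, Tt2}, {Tt2, Tj}}"

text \<open>Vertices of the superposition are \<open>Inl x\<close> for a vertex \<open>x\<close> of the given graph and \<open>Inr t\<close> for
  a vertex \<open>t\<close> of \<open>T\<close>. \<open>Link t\<close> is the new edge attached to the 2-valent vertex \<open>t\<close> of \<open>T\<close>;
  \<open>link_end\<close> is its other end.\<close>

datatype 'e sup_edge = Old 'e | Gadget "tvert set" | Link tvert

definition link_end :: "'v \<Rightarrow> 'v \<Rightarrow> 'v \<Rightarrow> 'v \<Rightarrow> 'v \<Rightarrow> tvert \<Rightarrow> 'v" where
  "link_end u1 u5 v2 v3 v4 t = (case t of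
      Ta \<Rightarrow> u1 | Tb \<Rightarrow> v2 | Tc \<Rightarrow> v3 | Td \<Rightarrow> v4 | Te \<Rightarrow> u5 | _ \<Rightarrow> undefined)"

definition superposition ::
  "('v, 'e) ugraph \<Rightarrow> 'v \<Rightarrow> 'v \<Rightarrow> 'v \<Rightarrow> 'v \<Rightarrow> 'v \<Rightarrow> 'v \<Rightarrow> 'v \<Rightarrow> 'v \<Rightarrow> ('v + tvert, 'e sup_edge) ugraph"
where
  "superposition G u1 u2 u3 u4 u5 v2 v3 v4 =
     \<lparr>verts = Inl ` (verts G - {u2, u3, u4}) \<union> range Inr,
      edges = Old ` {f \<in> edges G. ends G f \<inter> {u2, u3, u4} = {}} \<union> Gadget ` T_edges
                \<union> Link ` {Ta, Tb, Tc, Td, Te},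
      ends = (\<lambda>x. case x of
                Old f \<Rightarrow> Inl ` ends G f
              | Gadget X \<Rightarrow> Inr ` X
              | Link t \<Rightarrow> {Inl (link_end u1 u5 v2 v3 v4 t), Inr t})\<rparr>"

end

theory Submission imports Defs "HOL-Library.FuncSet"
begin

text \<open>The three colours are the nonzero elements of the Klein four-group, so that three edges at a vertex
  have distinct colours iff their colours sum to zero. A 3-edge-colouring of \<open>G\<^sub>e\<close> is then the same thing
  as a flow on \<open>G\<close> whose only zero is \<open>e\<close>: the two edges that remain at an end of \<open>e\<close> get the same
  colour, which is the colour of the merged edge. If \<open>G\<close> is not 3-edge-colourable, then Kempe chains
  show that the colours at the two ends of \<open>e\<close> are equidistributed over the nine pairs of colours, so
  the number of flows is a multiple of 9, and the number of decompositions is a multiple of 3.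

  For the superposition, a flow is split into its values outside the path \<open>u2, u3, u4\<close> (respectively
  outside \<open>T\<close>) and those inside. For every assignment of nonzero values to the five dangling edges,
  the number of ways to continue into \<open>T\<close> is exactly five times the number of ways to continue into
  the path, which is verified by enumeration.\<close>

section \<open>Colours as nonzero elements of the Klein four-group\<close>

datatype klein = K0 | K1 | K2 | K3

instantiation klein :: ab_group_add
begin

definition zero_klein :: klein where "0 = K0"

fun plus_klein :: "klein \<Rightarrow> klein \<Rightarrow> klein" where
  "K0 + y = y"
| "x + K0 = x"
| "K1 + K1 = K0" | "K1 + K2 = K3" | "K1 + K3 = K2"
| "K2 + K1 = K3" | "K2 + K2 = K0" | "K2 + K3 = K1"
| "K3 + K1 = K2" | "K3 + K2 = K1" | "K3 + K3 = K0"

definition uminus_klein :: "klein \<Rightarrow> klein" where "uminus_klein x = x"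

definition minus_klein :: "klein \<Rightarrow> klein \<Rightarrow> klein" where "minus_klein x y = x + y"

instance
proof
  fix a b c :: klein
  show "a + b + c = a + (b + c)" by (cases a; cases b; cases c; simp)
  show "a + b = b + a" by (cases a; cases b; simp)
  show "0 + a = a" by (cases a; simp add: zero_klein_def)
  show "- a + a = 0" by (cases a; simp add: zero_klein_def uminus_klein_def)
  show "a - b = a + - b" by (simp add: minus_klein_def uminus_klein_def)
qed

end

lemma UNIV_klein: "(UNIV :: klein set) = {K0, K1, K2, K3}"
  using klein.exhaust by auto

instance klein :: finite
  by standard (simp add: UNIV_klein)

lemma klein_add_self [simp]: "x + x = (0 :: klein)"
  by (cases x) (auto simp: zero_klein_def)

lemma klein_add_eq_0_iff: "x + y = 0 \<longleftrightarrow> x = (y :: klein)"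
  by (cases x; cases y) (auto simp: zero_klein_def)

lemma klein_add_add_self [simp]: "x + (x + y) = (y :: klein)"
  by (simp flip: add.assoc)

lemma nonzero_klein: "{k :: klein. k \<noteq> 0} = {K1, K2, K3}"
  using klein.exhaust by (auto simp: zero_klein_def)

lemma card_nonzero_klein: "card {k :: klein. k \<noteq> 0} = 3"
  by (simp add: nonzero_klein)

text \<open>Pairwise distinct nonzero elements are \<open>K1\<close>, \<open>K2\<close>,
  \<open>K3\<close>, whose sum is 0. If two of the three coincide, they cancel and leave the third,
  which is nonzero.\<close>

lemma klein_sum_eq_0_iff_inj_on:
  fixes g :: "'a \<Rightarrow> klein"
  assumes "card A = 3" and "\<And>x. x \<in> A \<Longrightarrow> g x \<noteq> 0"
  shows "sum g A = 0 \<longleftrightarrow> inj_on g A"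
proof -
  obtain x y z where A: "A = {x, y, z}" "x \<noteq> y" "x \<noteq> z" "y \<noteq> z"
    using assms(1) by (auto simp: card_3_iff)
  have "g x \<noteq> 0" "g y \<noteq> 0" "g z \<noteq> 0" using assms(2) A by auto
  then show ?thesis
    by (cases "g x"; cases "g y"; cases "g z") (auto simp: A zero_klein_def)
qed

section \<open>Stars of vertices, colourings and edge decompositions\<close>

definition star :: "('v, 'e) ugraph \<Rightarrow> 'v \<Rightarrow> 'e set" where
  "star G v = {x \<in> edges G. v \<in> ends G x}"

text \<open>Turns properness into a condition at each vertex, the form in which it can be compared
  with vanishing vertex sums.\<close>

lemma proper_iff_inj_on_star:
  assumes "\<And>x. x \<in> edges G \<Longrightarrow> ends G x \<subseteq> verts G"
  shows "(\<forall>e\<in>edges G. \<forall>f\<in>edges G. adjacent_edges G e f \<longrightarrow> c e \<noteq> c f)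
    \<longleftrightarrow> (\<forall>v\<in>verts G. inj_on c (star G v))"
  using assms unfolding adjacent_edges_def inj_on_def star_def by blast

definition colourings :: "('v, 'e) ugraph \<Rightarrow> 'c set \<Rightarrow> ('e \<Rightarrow> 'c) set" where
  "colourings G S = {c \<in> edges G \<rightarrow>\<^sub>E S.
     \<forall>e\<in>edges G. \<forall>f\<in>edges G. adjacent_edges G e f \<longrightarrow> c e \<noteq> c f}"

text \<open>A colouring that uses all colours amounts to a decomposition together with one of the 3!
  bijections from its classes to \<open>S\<close>. The assumption \<open>onto\<close> keeps every
  colour class nonempty, as \<open>partition_on\<close> demands.\<close>

lemma card_colourings:
  fixes G :: "('v, 'e) ugraph" and S :: "'c set"
  assumes fin: "finite (edges G)" and S: "card S = 3"
    and onto: "\<And>c. c \<in> colourings G S \<Longrightarrow> S \<subseteq> c ` edges G"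
  shows "card (colourings G S) = 6 * card (edge_decompositions3 G)"
proof -
  let ?D = "edge_decompositions3 G"
  let ?I = "\<lambda>P. {g \<in> P \<rightarrow>\<^sub>E S. inj_on g P}"
  \<comment> \<open>\<open>lab\<close> turns a labelled decomposition into a colouring: an edge
    receives the label of the unique class containing it.\<close>
  define lab where "lab = (\<lambda>(P, g :: 'e set \<Rightarrow> 'c). \<lambda>x\<in>edges G. g (THE X. X \<in> P \<and> x \<in> X))"
  have finS: "finite S" using S card.infinite by fastforce
  have finD: "finite ?D"
    by (rule finite_subset[of _ "Pow (Pow (edges G))"])
      (use fin in \<open>auto simp: edge_decompositions3_def partition_on_def\<close>)
  have P: "partition_on (edges G) P" "card P = 3" "finite P" if "P \<in> ?D" for P
    using that card.infinite by (force simp: edge_decompositions3_def)+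
  have block: "(THE X. X \<in> P \<and> x \<in> X) = X" if "P \<in> ?D" "X \<in> P" "x \<in> X" for P X x
    using P(1)[OF that(1)] that(2,3) by (intro the_equality) (auto dest: partition_onD2 disjointD)
  have sub: "X \<subseteq> edges G" if "P \<in> ?D" "X \<in> P" for P X
    using P(1)[OF that(1)] that(2) by (auto simp: partition_on_def)
  have ex: "\<exists>X\<in>P. x \<in> X" if "P \<in> ?D" "x \<in> edges G" for P x
    using P(1)[OF that(1)] that(2) by (auto simp: partition_on_def)
  have lab: "lab (P, g) x = g X" if "P \<in> ?D" "X \<in> P" "x \<in> X" for P g X x
    using block[OF that] sub[OF that(1,2)] that(3) by (auto simp: lab_def)
  have g_bij: "bij_betw g P S" if "P \<in> ?D" "g \<in> ?I P" for P g
  proof -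
    have "card (g ` P) = card S" "g ` P \<subseteq> S"
      using that P[OF that(1)] S by (auto simp: card_image)
    then show ?thesis using that finS by (auto simp: bij_betw_def dest: card_subset_eq)
  qed
  have fibre: "{x \<in> edges G. lab (P, g) x = g X} = X"
    if fib: "P \<in> ?D" "g \<in> ?I P" "X \<in> P" for P g X
  proof (intro equalityI subsetI)
    fix x assume x: "x \<in> {x \<in> edges G. lab (P, g) x = g X}"
    then obtain Y where "Y \<in> P" "x \<in> Y" using ex fib by blast
    then show "x \<in> X" using x lab fib by (auto dest: inj_onD)
  qed (use fib sub lab in auto)
  have "inj_on lab (Sigma ?D ?I)"
  proof (rule inj_onI)
    fix p q assume p: "p \<in> Sigma ?D ?I" and q: "q \<in> Sigma ?D ?I" and eq: "lab p = lab q"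
    obtain P g Q h where [simp]: "p = (P, g)" "q = (Q, h)" by (metis surj_pair)
    \<comment> \<open>The classes are the fibres of the colouring, so the colouring determines
      \<open>P\<close>; the labels are then read off at any element of each class.\<close>
    have blocks: "P = (\<lambda>s. {x \<in> edges G. lab (P, g) x = s}) ` S" if "(P, g) \<in> Sigma ?D ?I" for P g
    proof -
      have "P = (\<lambda>X. {x \<in> edges G. lab (P, g) x = g X}) ` P"
        using fibre that by auto
      also have "\<dots> = (\<lambda>s. {x \<in> edges G. lab (P, g) x = s}) ` S"
        using g_bij[of P g] that by (auto simp: bij_betw_def image_image dest!: sym[of _ S])
      finally show ?thesis .
    qed
    have PQ: "P = Q"
    proof -
      have "P = (\<lambda>s. {x \<in> edges G. lab (P, g) x = s}) ` S" using p by (intro blocks) simp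
      also have "\<dots> = (\<lambda>s. {x \<in> edges G. lab (Q, h) x = s}) ` S" using eq by simp
      also have "\<dots> = Q" using q by (intro blocks[symmetric]) simp
      finally show ?thesis .
    qed
    have "g X = h X" if X: "X \<in> P" for X
    proof -
      have "{} \<notin> P" using p P(1)[of P] by (auto dest: partition_onD3)
      then obtain x where "x \<in> X" using X by (metis ex_in_conv)
      then have "lab (P, g) x = g X" "lab (Q, h) x = h X" using lab X p q PQ by auto
      then show ?thesis using eq by simp
    qed
    then have "g = h" using p q PQ by (auto intro: PiE_ext)
    then show "p = q" using PQ by simp
  qed
  moreover have "lab ` Sigma ?D ?I = colourings G S"
  proof (intro equalityI subsetI)
    fix c assume "c \<in> lab ` Sigma ?D ?I"
    then obtain P g where Pg: "P \<in> ?D" "g \<in> ?I P" and c: "c = lab (P, g)" by auto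
    have "c e \<noteq> c f" if ef: "e \<in> edges G" "f \<in> edges G" "adjacent_edges G e f" for e f
    proof -
      obtain X Y where XY: "X \<in> P" "e \<in> X" "Y \<in> P" "f \<in> Y" using ex Pg ef by meson
      then have "X \<noteq> Y" using Pg ef(3) by (auto simp: edge_decompositions3_def)
      then show ?thesis using XY Pg lab c by (auto dest: inj_onD)
    qed
    moreover have "c x \<in> S" if "x \<in> edges G" for x
      using ex[OF Pg(1) that] lab[OF Pg(1)] Pg c by auto
    ultimately show "c \<in> colourings G S"
      by (auto simp: colourings_def c lab_def)
  next
    fix c assume c: "c \<in> colourings G S"
    define K where "K s = {x \<in> edges G. c x = s}" for s
    define P where "P = K ` S"
    have cS: "c x \<in> S" if "x \<in> edges G" for x using c that by (auto simp: colourings_def)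
    have "K s \<noteq> {}" if "s \<in> S" for s using onto[OF c] that by (auto simp: K_def)
    moreover have "inj_on K S" using calculation by (force simp: inj_on_def K_def)
    ultimately have Kne: "K s \<noteq> {}" and "card P = 3" if "s \<in> S" for s
      using that S by (auto simp: P_def card_image)
    then have "card P = 3" using S by force
    moreover have "partition_on (edges G) P"
      using Kne cS by (auto simp: partition_on_def disjoint_def P_def) (auto simp: K_def)
    moreover have "\<not> adjacent_edges G e f" if "X \<in> P" "e \<in> X" "f \<in> X" for X e f
    proof -
      have "e \<in> edges G" "f \<in> edges G" "c e = c f" using that by (auto simp: P_def K_def)
      then show ?thesis using c by (auto simp: colourings_def)
    qed
    ultimately have PD: "P \<in> ?D" by (auto simp: edge_decompositions3_def)
    \<comment> \<open>A class is monochromatic, so any representative reveals its colour.\<close>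
    define g where "g = (\<lambda>X\<in>P. c (SOME x. x \<in> X))"
    have g: "g (K s) = s" if "s \<in> S" for s
    proof -
      have "K s \<in> P" using that P_def by blast
      moreover have "(SOME x. x \<in> K s) \<in> K s" using Kne that
        by (meson ex_in_conv someI_ex)
      ultimately show ?thesis by (simp add: g_def K_def)
    qed
    have "g \<in> ?I P" using g by (auto simp: P_def inj_on_def g_def)
    moreover have "lab (P, g) = c"
    proof
      fix x show "lab (P, g) x = c x"
      proof (cases "x \<in> edges G")
        case True
        then show ?thesis using lab[OF PD, of "K (c x)" x g] cS g by (auto simp: P_def K_def)
      next
        case False
        then show ?thesis using c by (auto simp: lab_def colourings_def PiE_def extensional_def)
      qed
    qed
    ultimately show "c \<in> lab ` Sigma ?D ?I" using PD by force
  qed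
  ultimately have "card (colourings G S) = card (Sigma ?D ?I)"
    using card_image by fastforce
  also have "\<dots> = (\<Sum>P\<in>?D. card (?I P))"
  proof (rule card_SigmaI)
    have "finite (?I P)" if "P \<in> ?D" for P
      by (rule finite_subset[of _ "P \<rightarrow>\<^sub>E S"]) (use P(3)[OF that] finS in \<open>auto intro: finite_PiE\<close>)
    then show "\<forall>P\<in>?D. finite (?I P)" by blast
  qed (rule finD)
  also have "\<dots> = (\<Sum>P\<in>?D. 6)"
  proof (rule sum.cong)
    fix P assume "P \<in> ?D"
    \<comment> \<open>There are 3 * 2 * 1 injections between two three-element sets.\<close>
    then show "card (?I P) = 6"
      using card_inj_on_subset_funcset[of P S P] P[of P] finS S by (simp add: numeral_3_eq_3)
  qed simp
  finally show ?thesis by simp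
qed

section \<open>Flows and edge subtraction\<close>

text \<open>Every group element is its own inverse, so conservation at a vertex needs no orientation
  of the edges. Requiring \<open>extensional\<close> functions makes the set finite.\<close>

definition flows :: "('v, 'e) ugraph \<Rightarrow> 'e \<Rightarrow> ('e \<Rightarrow> klein) set" where
  "flows G e = {\<phi> \<in> extensional (edges G).
     (\<forall>x\<in>edges G. \<phi> x = 0 \<longleftrightarrow> x = e) \<and> (\<forall>v\<in>verts G. sum \<phi> (star G v) = 0)}"

lemma finite_extensional_klein: "finite A \<Longrightarrow> finite (extensional A :: ('a \<Rightarrow> klein) set)"
  using finite_PiE[of A "\<lambda>_. UNIV :: klein set"] by (simp add: PiE_UNIV_domain PiE_def)

lemma finite_flows: "finite (edges G) \<Longrightarrow> finite (flows G e)"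
  by (rule finite_subset[OF _ finite_extensional_klein[of "edges G"]]) (auto simp: flows_def)

text \<open>The common setting for the given graph and its superposition: finite cubic graphs
  without loops or multiple edges. As every edge has two ends, the degree of a vertex is the size of
  its star.\<close>

locale cubic_graph =
  fixes G :: "('v, 'e) ugraph"
  assumes finite_verts: "finite (verts G)"
    and ends_subset: "x \<in> edges G \<Longrightarrow> ends G x \<subseteq> verts G"
    and card_ends: "x \<in> edges G \<Longrightarrow> card (ends G x) = 2"
    and inj_ends: "inj_on (ends G) (edges G)"
    and card_star: "v \<in> verts G \<Longrightarrow> card (star G v) = 3"
begin

lemma finite_edges: "finite (edges G)"
proof -
  have "ends G ` edges G \<subseteq> Pow (verts G)" using ends_subset by auto
  then show ?thesis using finite_verts inj_ends by (meson finite_Pow_iff finite_imageD finite_subset)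
qed

lemma finite_star: "finite (star G v)"
  using finite_edges by (simp add: star_def)

lemma ends_eqD: "x \<in> edges G \<Longrightarrow> y \<in> edges G \<Longrightarrow> ends G x = ends G y \<Longrightarrow> x = y"
  using inj_ends by (auto dest: inj_onD)

lemma ends_pair: "x \<in> edges G \<Longrightarrow> p \<in> ends G x \<Longrightarrow> q \<in> ends G x \<Longrightarrow> p \<noteq> q \<Longrightarrow> ends G x = {p, q}"
  using card_ends[of x] by (auto simp: card_2_iff)

text \<open>At each vertex three nonzero values with sum 0 are distinct, so the flow itself is a
  proper colouring up to renaming the colours.\<close>

lemma nowhere_zero_flow_colourable:
  assumes nz: "\<And>x. x \<in> edges G \<Longrightarrow> \<phi> x \<noteq> (0 :: klein)"
    and flow: "\<And>v. v \<in> verts G \<Longrightarrow> sum \<phi> (star G v) = 0"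
  shows "edge_colourable3 G"
proof -
  \<comment> \<open>\<open>K0\<close> shares a code with \<open>K3\<close>, which is harmless
    because only nonzero values are encoded.\<close>
  define enc :: "klein \<Rightarrow> nat" where "enc k = (case k of K1 \<Rightarrow> 0 | K2 \<Rightarrow> 1 | _ \<Rightarrow> 2)" for k
  have enc: "enc k < 3" for k by (cases k) (auto simp: enc_def)
  have enc_inj: "k = l" if "enc k = enc l" "k \<noteq> 0" "l \<noteq> 0" for k l
    using that by (cases k; cases l) (auto simp: enc_def zero_klein_def)
  have "inj_on \<phi> (star G v)" if "v \<in> verts G" for v
    using klein_sum_eq_0_iff_inj_on[OF card_star[OF that], of \<phi>] nz flow[OF that]
    by (auto simp: star_def)
  then have "\<forall>e\<in>edges G. \<forall>f\<in>edges G. adjacent_edges G e f \<longrightarrow> \<phi> e \<noteq> \<phi> f"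
    using proper_iff_inj_on_star[of G \<phi>] ends_subset by blast
  then have "enc (\<phi> e) \<noteq> enc (\<phi> f)" if "e \<in> edges G" "f \<in> edges G" "adjacent_edges G e f" for e f
    using that enc_inj[of "\<phi> e" "\<phi> f"] nz by blast
  then have "edge_colouring3 G (enc \<circ> \<phi>)"
    using enc by (simp add: edge_colouring3_def)
  then show ?thesis by (auto simp: edge_colourable3_def)
qed

text \<open>Pulling colourings of the subtracted graph back along \<open>\<pi>\<close> gives exactly
  the flows: at an end of \<open>e\<close> a zero sum says that the two other edges agree, so their
  value descends to the merged edge. Six colourings per decomposition give the factor.\<close>

lemma card_flows_eq_decompositions:
  assumes e: "e \<in> edges G"
  shows "card (flows G e) = 6 * card (edge_decompositions3 (subtract_edge G e))"
proof -
  let ?H = "subtract_edge G e"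
  let ?S = "{k. k \<noteq> (0 :: klein)}"
  \<comment> \<open>\<open>\<pi>\<close> sends an edge to the edge it becomes after subtraction.
    Since there are no multiple edges, an edge other than \<open>e\<close> meets \<open>e\<close> in
    at most one vertex, so \<open>the_elem\<close> is meaningful there. The value at
    \<open>e\<close> itself is never relied on.\<close>
  define \<pi> :: "'e \<Rightarrow> ('v, 'e) sub_edge" where
    "\<pi> f = (if ends G f \<inter> ends G e = {} then Kept f else Merged (the_elem (ends G f \<inter> ends G e)))" for f
  have \<pi>_kept: "\<pi> f = Kept f" if "ends G f \<inter> ends G e = {}" for f
    using that by (simp add: \<pi>_def)
  have \<pi>_merged: "\<pi> f = Merged w" if "f \<in> edges G" "f \<noteq> e" "w \<in> ends G f" "w \<in> ends G e" for f w
  proof -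
    have ne: "ends G f \<noteq> ends G e" using ends_eqD that e by metis
    have "p = w" if p: "p \<in> ends G f" "p \<in> ends G e" for p
    proof (rule ccontr)
      assume "p \<noteq> w"
      then show False
        using ne ends_pair[of f w p] ends_pair[of e w p] p \<open>f \<in> edges G\<close> \<open>w \<in> ends G f\<close>
          \<open>w \<in> ends G e\<close> e by simp
    qed
    then have "ends G f \<inter> ends G e = {w}" using that by blast
    then show ?thesis by (simp add: \<pi>_def)
  qed
  have H: "edges ?H = Kept ` {f \<in> edges G. ends G f \<inter> ends G e = {}} \<union> Merged ` ends G e"
    "verts ?H = verts G - ends G e"
    "ends ?H (Kept f) = ends G f" "ends ?H (Merged w) = {p. \<exists>f\<in>edges G - {e}. ends G f = {w, p}}" for f w
    by (auto simp: subtract_edge_def)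
  have star_e: "e \<in> star G w" "w \<in> verts G" if "w \<in> ends G e" for w
    using that e ends_subset by (auto simp: star_def)
  have \<pi>_in: "\<pi> f \<in> edges ?H" if f: "f \<in> edges G" "f \<noteq> e" for f
  proof (cases "ends G f \<inter> ends G e = {}")
    case False
    then obtain w where "w \<in> ends G f" "w \<in> ends G e" by blast
    then show ?thesis using \<pi>_merged[OF f] by (simp add: H)
  qed (use f in \<open>simp add: \<pi>_kept H\<close>)
  have \<pi>_onto: "\<exists>f\<in>edges G. f \<noteq> e \<and> \<pi> f = y" if y: "y \<in> edges ?H" for y
  proof (cases y)
    case (Kept f)
    then have "f \<in> edges G" "ends G f \<inter> ends G e = {}" using y by (auto simp: H)
    moreover have "ends G e \<noteq> {}" using card_ends[OF e] by auto
    ultimately show ?thesis using Kept \<pi>_kept by (intro bexI[of _ f]) auto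
  next
    case (Merged w)
    then have w: "w \<in> ends G e" using y by (auto simp: H)
    have "card (star G w - {e}) = 2" using card_star star_e[OF w] by simp
    then obtain f where "f \<in> star G w - {e}" by (metis all_not_in_conv card.empty zero_neq_numeral)
    then show ?thesis using Merged \<pi>_merged[of f w] w by (auto simp: star_def intro!: bexI[of _ f])
  qed
  have ends_H: "ends ?H y \<subseteq> verts ?H" if y: "y \<in> edges ?H" for y
  proof (cases y)
    case (Kept f)
    then show ?thesis using y ends_subset by (auto simp: H)
  next
    case (Merged w)
    then have w: "w \<in> ends G e" using y by (auto simp: H)
    have "p \<in> verts ?H" if f: "f \<in> edges G" "f \<noteq> e" "ends G f = {w, p}" for f p
    proof -
      have "p \<noteq> w" using f card_ends[of f] by auto
      then have "p \<notin> ends G e" using ends_pair[OF e w, of p] ends_eqD[of f e] f e by auto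
      then show ?thesis using f ends_subset[of f] by (auto simp: H)
    qed
    then show ?thesis using Merged by (auto simp: H)
  qed
  \<comment> \<open>Two edges at a surviving vertex \<open>p\<close> that merge into one would both
    be \<open>{w, p}\<close> for the same end \<open>w\<close> of \<open>e\<close>, hence equal.
    Thus stars of surviving vertices are carried over without collapse.\<close>
  have star_H: "bij_betw \<pi> (star G p) (star ?H p)" if p: "p \<in> verts ?H" for p
    unfolding bij_betw_def
  proof (intro conjI inj_onI equalityI subsetI)
    fix f g assume fg: "f \<in> star G p" "g \<in> star G p" "\<pi> f = \<pi> g"
    have p': "p \<notin> ends G e" using p by (simp add: H)
    show "f = g"
    proof (cases "ends G f \<inter> ends G e = {}")
      case True
      then show ?thesis using fg(3) by (auto simp: \<pi>_def split: if_splits)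
    next
      case False
      then obtain w where w: "w \<in> ends G f" "w \<in> ends G e" by blast
      have "\<pi> g = Merged w" using fg \<pi>_merged[of f w] w p' by (auto simp: star_def)
      then have "ends G g \<inter> ends G e \<noteq> {}" using \<pi>_kept by force
      then obtain w' where w': "w' \<in> ends G g" "w' \<in> ends G e" by blast
      then have "w' = w" using \<open>\<pi> g = Merged w\<close> \<pi>_merged[of g w'] fg p' by (auto simp: star_def)
      then have "ends G f = ends G g"
        using ends_pair[of f w p] ends_pair[of g w p] w w' p' fg by (auto simp: star_def)
      then show ?thesis using fg ends_eqD by (auto simp: star_def)
    qed
  next
    fix y assume "y \<in> \<pi> ` star G p"
    then obtain f where f: "f \<in> edges G" "p \<in> ends G f" "y = \<pi> f" by (auto simp: star_def)
    have fe: "f \<noteq> e" using p f by (auto simp: H)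
    have "p \<in> ends ?H (\<pi> f)"
    proof (cases "ends G f \<inter> ends G e = {}")
      case True
      then show ?thesis using f by (simp add: \<pi>_kept H)
    next
      case False
      then obtain w where w: "w \<in> ends G f" "w \<in> ends G e" by blast
      then have "ends G f = {w, p}" using ends_pair[of f w p] f p by (auto simp: H)
      then show ?thesis using \<pi>_merged[OF f(1) fe w] f fe by (auto simp: H)
    qed
    then show "y \<in> star ?H p" using \<pi>_in[OF f(1) fe] f by (simp add: star_def)
  next
    fix y assume "y \<in> star ?H p"
    then have y: "y \<in> edges ?H" "p \<in> ends ?H y" by (auto simp: star_def)
    show "y \<in> \<pi> ` star G p"
    proof (cases y)
      case (Kept f)
      then have "f \<in> star G p" "\<pi> f = y" using y by (auto simp: H star_def \<pi>_kept)
      then show ?thesis by blast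
    next
      case (Merged w)
      then obtain f where f: "f \<in> edges G" "f \<noteq> e" "ends G f = {w, p}" "w \<in> ends G e"
        using y by (auto simp: H)
      then have "f \<in> star G p" "\<pi> f = y" using \<pi>_merged[of f w] Merged by (auto simp: star_def)
      then show ?thesis by blast
    qed
  qed
  have vertex_cond: "sum \<phi> (star G p) = 0 \<longleftrightarrow> inj_on c (star ?H p)"
    if p: "p \<in> verts ?H" and \<phi>: "\<And>f. f \<in> star G p \<Longrightarrow> \<phi> f = c (\<pi> f)"
      and c: "\<And>y. y \<in> edges ?H \<Longrightarrow> c y \<noteq> (0 :: klein)" for \<phi> c p
  proof -
    have "card (star ?H p) = 3"
      using bij_betw_same_card[OF star_H[OF p]] card_star[of p] p by (simp add: H)
    moreover have "sum \<phi> (star G p) = sum c (star ?H p)"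
      using sum.reindex_bij_betw[OF star_H[OF p], of c] \<phi> by simp
    ultimately show ?thesis using klein_sum_eq_0_iff_inj_on[of "star ?H p" c] c
      by (simp add: star_def)
  qed
  \<comment> \<open>The zero on \<open>e\<close> drops out, and two elements sum to 0 iff they are
    equal.\<close>
  have end_cond: "sum \<phi> (star G w) = 0 \<longleftrightarrow> (\<forall>f\<in>star G w - {e}. \<forall>g\<in>star G w - {e}. \<phi> f = \<phi> g)"
    if w: "w \<in> ends G e" and "\<phi> e = (0 :: klein)" for \<phi> w
  proof -
    have "card (star G w - {e}) = 2" using card_star star_e[OF w] by simp
    then obtain f g where fg: "star G w - {e} = {f, g}" "f \<noteq> g" by (auto simp: card_2_iff)
    have "sum \<phi> (star G w) = \<phi> e + sum \<phi> (star G w - {e})"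
      by (rule sum.remove[OF finite_star star_e(1)[OF w]])
    also have "\<dots> = \<phi> f + \<phi> g" unfolding fg(1) using that(2) fg(2) by simp
    finally have "sum \<phi> (star G w) = 0 \<longleftrightarrow> \<phi> f = \<phi> g" by (simp add: klein_add_eq_0_iff)
    then show ?thesis unfolding fg(1) by auto
  qed
  define lift where "lift c = (\<lambda>f\<in>edges G. if f = e then 0 else c (\<pi> f))" for c :: "_ \<Rightarrow> klein"
  let ?C = "colourings ?H ?S"
  have C: "c \<in> ?C \<longleftrightarrow> c \<in> edges ?H \<rightarrow>\<^sub>E ?S \<and> (\<forall>p\<in>verts ?H. inj_on c (star ?H p))" for c
    using proper_iff_inj_on_star[of ?H c] ends_H by (auto simp: colourings_def)
  have "inj_on lift ?C"
  proof (rule inj_onI)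
    fix c d assume cd: "c \<in> ?C" "d \<in> ?C" "lift c = lift d"
    have "c y = d y" if y: "y \<in> edges ?H" for y
    proof -
      obtain f where "f \<in> edges G" "f \<noteq> e" "\<pi> f = y" using \<pi>_onto y by blast
      then show ?thesis using fun_cong[OF cd(3), of f] by (simp add: lift_def)
    qed
    then show "c = d" using cd by (auto simp: C intro: PiE_ext)
  qed
  moreover have "lift ` ?C = flows G e"
  proof (intro equalityI subsetI)
    fix \<phi> assume "\<phi> \<in> lift ` ?C"
    then obtain c where c: "c \<in> ?C" "\<phi> = lift c" by blast
    have c0: "c y \<noteq> 0" if "y \<in> edges ?H" for y using c(1) that by (auto simp: C)
    have \<phi>: "\<phi> f = c (\<pi> f)" if "f \<in> edges G" "f \<noteq> e" for f using that c by (simp add: lift_def)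
    have \<phi>e: "\<phi> e = 0" using e by (simp add: c lift_def)
    have "sum \<phi> (star G p) = 0" if p: "p \<in> verts G" for p
    proof (cases "p \<in> ends G e")
      case True
      have "\<phi> f = c (Merged p)" if "f \<in> star G p - {e}" for f
        using that \<phi> \<pi>_merged[of f p] True by (auto simp: star_def)
      then show ?thesis using end_cond[OF True, of \<phi>] \<phi>e by simp
    next
      case False
      then have pH: "p \<in> verts ?H" using p by (simp add: H)
      have agree: "\<phi> f = c (\<pi> f)" if "f \<in> star G p" for f
        using that False e by (intro \<phi>) (auto simp: star_def)
      show ?thesis using vertex_cond[of p \<phi> c, OF pH agree c0] c(1) pH by (simp add: C)
    qed
    then show "\<phi> \<in> flows G e"
      using \<phi> \<phi>e c0 \<pi>_in by (auto simp: flows_def c lift_def)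
  next
    fix \<phi> assume \<phi>: "\<phi> \<in> flows G e"
    \<comment> \<open>An edge \<open>Merged w\<close> arises from two edges of \<open>G\<close>; the
      fact \<open>same\<close> below makes the choice between them immaterial.\<close>
    define c where "c = (\<lambda>y\<in>edges ?H. \<phi> (SOME f. f \<in> edges G \<and> f \<noteq> e \<and> \<pi> f = y))"
    have same: "\<phi> f = \<phi> g" if fg: "f \<in> edges G" "f \<noteq> e" "g \<in> edges G" "g \<noteq> e" "\<pi> f = \<pi> g" for f g
    proof (cases "ends G f \<inter> ends G e = {}")
      case True
      then show ?thesis using fg by (auto simp: \<pi>_def split: if_splits)
    next
      case False
      then obtain w where w: "w \<in> ends G f" "w \<in> ends G e" by blast
      have "\<pi> g = Merged w" using fg \<pi>_merged[of f w] w by auto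
      then have "ends G g \<inter> ends G e \<noteq> {}" using \<pi>_kept by force
      then obtain w' where w': "w' \<in> ends G g" "w' \<in> ends G e" by blast
      then have "w' = w" using \<open>\<pi> g = Merged w\<close> \<pi>_merged[of g w'] fg by auto
      then have "f \<in> star G w - {e}" "g \<in> star G w - {e}" using w w' fg by (auto simp: star_def)
      moreover have "sum \<phi> (star G w) = 0" "\<phi> e = 0"
        using \<phi> star_e[OF w(2)] e by (auto simp: flows_def)
      ultimately show ?thesis using end_cond[OF w(2), of \<phi>] by blast
    qed
    have c\<pi>: "c (\<pi> f) = \<phi> f" if f: "f \<in> edges G" "f \<noteq> e" for f
    proof -
      define g where "g = (SOME g. g \<in> edges G \<and> g \<noteq> e \<and> \<pi> g = \<pi> f)"
      have "g \<in> edges G \<and> g \<noteq> e \<and> \<pi> g = \<pi> f"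
        unfolding g_def by (rule someI_ex) (use f in blast)
      then have "\<phi> g = \<phi> f" using f same[of g f] by simp
      then show ?thesis using \<pi>_in[OF f] by (simp add: c_def g_def)
    qed
    have c0: "c y \<noteq> 0" if y: "y \<in> edges ?H" for y
    proof -
      obtain f where "f \<in> edges G" "f \<noteq> e" "\<pi> f = y" using \<pi>_onto y by blast
      then show ?thesis using c\<pi>[of f] \<phi> by (auto simp: flows_def)
    qed
    have "inj_on c (star ?H p)" if p: "p \<in> verts ?H" for p
    proof -
      have agree: "\<phi> f = c (\<pi> f)" if "f \<in> star G p" for f
        using that p by (intro c\<pi>[symmetric]) (auto simp: star_def H)
      show ?thesis using vertex_cond[of p \<phi> c, OF p agree c0] \<phi> p by (simp add: flows_def H)
    qed
    then have "c \<in> ?C" using c0 by (auto simp: C c_def)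
    moreover have "\<phi> = lift c"
      using \<phi> c\<pi> e by (auto simp: flows_def lift_def extensional_def fun_eq_iff)
    ultimately show "\<phi> \<in> lift ` ?C" by blast
  qed
  ultimately have "card (flows G e) = card ?C" using card_image by fastforce
  \<comment> \<open>All colours occur: following an edge from an end \<open>u\<close> of
    \<open>e\<close> leads to a surviving vertex \<open>p\<close>, whose three edges have three
    distinct colours.\<close>
  moreover have "?S \<subseteq> c ` edges ?H" if c: "c \<in> ?C" for c
  proof -
    obtain u where u: "u \<in> ends G e" using card_ends[OF e] by fastforce
    then have "Merged u \<in> edges ?H" by (simp add: H)
    then obtain f where f: "f \<in> edges G" "f \<noteq> e" "\<pi> f = Merged u" using \<pi>_onto by blast
    then have uf: "u \<in> ends G f" using \<pi>_kept \<pi>_merged by fastforce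
    then obtain p where "ends G f = {u, p}"
      using card_ends[OF f(1)] by (auto simp: card_2_iff doubleton_eq_iff)
    then have "p \<in> ends ?H (Merged u)" using f by (auto simp: H)
    then have p: "p \<in> verts ?H" using ends_H \<open>Merged u \<in> edges ?H\<close> by blast
    have "card (star ?H p) = 3"
      using bij_betw_same_card[OF star_H[OF p]] card_star[of p] p by (simp add: H)
    then have "card (c ` star ?H p) = 3" using c p by (simp add: C card_image)
    moreover have "c ` star ?H p \<subseteq> ?S" using c by (auto simp: C star_def)
    ultimately have "c ` star ?H p = ?S" by (intro card_subset_eq) (simp_all add: card_nonzero_klein)
    then show ?thesis by (auto simp: star_def)
  qed
  moreover have "finite (edges ?H)"
    using finite_edges card_ends[OF e] card.infinite by (fastforce simp: H)
  ultimately show ?thesis using card_colourings[of ?H ?S] card_nonzero_klein by simp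
qed

end

section \<open>Kempe chains\<close>

text \<open>When \<open>A\<close> consists of the edges with two given colours, the vertices
  reachable from \<open>u\<close> are those of the Kempe chain of \<open>u\<close>.\<close>

inductive reachable :: "('v, 'e) ugraph \<Rightarrow> 'e set \<Rightarrow> 'v \<Rightarrow> 'v \<Rightarrow> bool" for G A u where
  refl: "reachable G A u u"
| step: "reachable G A u p \<Longrightarrow> x \<in> A \<Longrightarrow> ends G x = {p, q} \<Longrightarrow> reachable G A u q"

definition swap_colours :: "klein \<Rightarrow> klein \<Rightarrow> klein \<Rightarrow> klein" where
  "swap_colours a b k = (if k = a \<or> k = b then k + (a + b) else k)"

text \<open>Exchanging two nonzero elements is an automorphism of the Klein four-group, so swapping
  colours preserves vanishing vertex sums.\<close>

lemma swap_colours_add: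
  assumes "a \<noteq> 0" "b \<noteq> 0"
  shows "swap_colours a b (x + y) = swap_colours a b x + swap_colours a b y"
  using assms by (cases a; cases b; cases x; cases y) (simp_all add: swap_colours_def zero_klein_def)

lemma swap_colours_0 [simp]: "a \<noteq> 0 \<Longrightarrow> b \<noteq> 0 \<Longrightarrow> swap_colours a b 0 = 0"
  by (simp add: swap_colours_def)

lemma swap_colours_eq_0_iff: "a \<noteq> 0 \<Longrightarrow> b \<noteq> 0 \<Longrightarrow> swap_colours a b k = 0 \<longleftrightarrow> k = 0"
  by (cases a; cases b; cases k) (simp_all add: swap_colours_def zero_klein_def)

lemma swap_colours_in_iff: "swap_colours a b k \<in> {a, b} \<longleftrightarrow> k \<in> {a, b}"
  by (cases a; cases b; cases k) (simp_all add: swap_colours_def zero_klein_def)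

lemma swap_colours_involutive: "swap_colours a b (swap_colours a b k) = k"
  by (cases a; cases b; cases k) (simp_all add: swap_colours_def zero_klein_def)

lemma swap_colours_left: "swap_colours a b a = b"
  by (simp add: swap_colours_def)

lemma swap_colours_sum:
  "a \<noteq> 0 \<Longrightarrow> b \<noteq> 0 \<Longrightarrow> swap_colours a b (sum \<phi> A) = (\<Sum>x\<in>A. swap_colours a b (\<phi> x))"
  by (induction A rule: infinite_finite_induct) (simp_all add: swap_colours_add)

context cubic_graph
begin

text \<open>Adding \<open>c\<close> on each edge of a walk from \<open>u\<close> to \<open>p\<close>
  leaves a contribution only at the two end vertices. Repeated edges and interior visits cancel
  because \<open>c + c = 0\<close>, so the walk may repeat vertices, and for \<open>u = p\<close>
  both sides vanish.\<close>

lemma reachable_chain: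
  fixes c :: klein
  assumes "reachable G A u p" and "A \<subseteq> edges G"
  obtains g where "\<And>x. g x = 0 \<or> g x = c" and "\<And>x. x \<notin> A \<Longrightarrow> g x = 0"
    and "\<And>v. sum g (star G v) = (if v = u then c else 0) + (if v = p then c else 0)"
proof -
  have "\<exists>g. (\<forall>x. g x = 0 \<or> g x = c) \<and> (\<forall>x. x \<notin> A \<longrightarrow> g x = 0) \<and>
      (\<forall>v. sum g (star G v) = (if v = u then c else 0) + (if v = p then c else 0))"
    using assms(1)
  proof induction
    case refl
    then show ?case by (intro exI[of _ "\<lambda>_. 0"]) auto
  next
    case (step p x q)
    then obtain g where g: "\<forall>x. g x = 0 \<or> g x = c" "\<forall>x. x \<notin> A \<longrightarrow> g x = 0"
      "\<forall>v. sum g (star G v) = (if v = u then c else 0) + (if v = p then c else 0)" by blast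
    have x: "x \<in> edges G" using step assms(2) by blast
    have "p \<noteq> q" using card_ends[OF x] step by auto
    have "sum (g(x := g x + c)) (star G v) = (if v = u then c else 0) + (if v = q then c else 0)" for v
    proof -
      have "sum (g(x := g x + c)) (star G v) = (\<Sum>y\<in>star G v. g y + (if y = x then c else 0))"
        by (intro sum.cong) auto
      also have "\<dots> = sum g (star G v) + (if v = p \<or> v = q then c else 0)"
        using finite_star x step by (auto simp: sum.distrib star_def)
      finally show ?thesis using g(3) \<open>p \<noteq> q\<close> by (auto simp: ac_simps)
    qed
    then show ?case using g step by (intro exI[of _ "g(x := g x + c)"]) auto
  qed
  then show thesis using that by blast
qed

text \<open>If the Kempe chain of the colours \<open>a\<close>, \<open>b\<close> starting at \<open>u\<close> reached \<open>v\<close>, then adding \<open>a + b\<close>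
  along it and on \<open>e\<close> would turn the flow into a nowhere-zero one.\<close>

lemma Kempe_chain_avoids:
  assumes nc: "\<not> edge_colourable3 G" and e: "e \<in> edges G" "ends G e = {u, v}"
    and ab: "a \<noteq> 0" "b \<noteq> 0" "a \<noteq> b" and \<phi>: "\<phi> \<in> flows G e"
  shows "\<not> reachable G {x \<in> edges G. \<phi> x \<in> {a, b}} u v"
proof
  let ?A = "{x \<in> edges G. \<phi> x \<in> {a, b}}" and ?c = "a + b"
  assume "reachable G ?A u v"
  moreover have "?A \<subseteq> edges G" by blast
  ultimately obtain g where g: "\<And>x. g x = 0 \<or> g x = ?c" "\<And>x. x \<notin> ?A \<Longrightarrow> g x = 0"
    "\<And>w. sum g (star G w) = (if w = u then ?c else 0) + (if w = v then ?c else 0)"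
    using reachable_chain by blast
  have uv: "u \<noteq> v" using card_ends[OF e(1)] e(2) by auto
  define \<psi> where "\<psi> x = \<phi> x + g x + (if x = e then ?c else 0)" for x
  have c: "?c \<noteq> 0" using ab by (simp add: klein_add_eq_0_iff)
  \<comment> \<open>Adding 0 or \<open>a + b\<close> to a colour in \<open>{a, b}\<close> yields
    again a colour in \<open>{a, b}\<close>, which is nonzero.\<close>
  have shift: "k + l \<noteq> 0" if "k \<in> {a, b}" "l = 0 \<or> l = ?c" for k l
    using that ab by (auto simp: klein_add_eq_0_iff)
  have "\<psi> x \<noteq> 0" if x: "x \<in> edges G" for x
  proof (cases "x = e")
    case True
    then have "\<phi> x = 0" using \<phi> e by (auto simp: flows_def)
    then show ?thesis using True g(2)[of x] ab c by (auto simp: \<psi>_def)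
  next
    case False
    then have "\<phi> x \<noteq> 0" using \<phi> x by (auto simp: flows_def)
    moreover have "\<psi> x = \<phi> x + g x" using False by (simp add: \<psi>_def)
    ultimately show ?thesis
      using g(1)[of x] g(2)[of x] shift[of "\<phi> x" "g x"] x by (cases "x \<in> ?A") simp_all
  qed
  moreover have "sum \<psi> (star G w) = 0" if w: "w \<in> verts G" for w
  proof -
    have "sum \<psi> (star G w) = sum \<phi> (star G w) + sum g (star G w) + (if w \<in> {u, v} then ?c else 0)"
      using finite_star[of w] e by (auto simp: \<psi>_def sum.distrib star_def)
    then show ?thesis using g(3)[of w] \<phi> w uv by (auto simp: flows_def)
  qed
  ultimately show False using nc nowhere_zero_flow_colourable by blast
qed

text \<open>Swapping \<open>a\<close> and \<open>b\<close> along the Kempe chain of \<open>u\<close>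
  is an involution on flows. It changes the value \<open>a\<close> at \<open>f\<close> into
  \<open>b\<close>, and it leaves \<open>g\<close> alone since the chain does not reach
  \<open>v\<close>.\<close>

lemma card_flows_Kempe_le:
  assumes nc: "\<not> edge_colourable3 G" and e: "e \<in> edges G" "ends G e = {u, v}"
    and ab: "a \<noteq> 0" "b \<noteq> 0" "a \<noteq> b" and f: "f \<in> star G u" and g: "g \<in> star G v"
  shows "card {\<phi> \<in> flows G e. \<phi> f = a \<and> \<phi> g = c} \<le> card {\<phi> \<in> flows G e. \<phi> f = b \<and> \<phi> g = c}"
proof -
  define A where "A \<phi> = {x \<in> edges G. \<phi> x \<in> {a, b}}" for \<phi> :: "'e \<Rightarrow> klein"
  define K where "K \<phi> = {p. reachable G (A \<phi>) u p}" for \<phi>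
  \<comment> \<open>One end in the chain suffices for an edge to be swapped: an edge with just one
    end there has a value outside \<open>{a, b}\<close>, which the swap fixes. So at each vertex
    \<open>T\<close> acts either as the swap on the whole star or as the identity.\<close>
  define T where "T \<phi> = (\<lambda>x\<in>edges G. if ends G x \<inter> K \<phi> \<noteq> {} then swap_colours a b (\<phi> x) else \<phi> x)" for \<phi>
  have uK: "u \<in> K \<phi>" for \<phi> by (simp add: K_def reachable.refl)
  have T_in: "T \<phi> x = swap_colours a b (\<phi> x)" if "p \<in> K \<phi>" "x \<in> star G p" for \<phi> p x
    using that by (auto simp: T_def star_def)
  have T_out: "T \<phi> x = \<phi> x" if p: "p \<notin> K \<phi>" "x \<in> star G p" for \<phi> p x
  proof (cases "ends G x \<inter> K \<phi> = {}")
    case False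
    then obtain q where q: "q \<in> ends G x" "q \<in> K \<phi>" by blast
    then have "ends G x = {q, p}" using ends_pair[of x q p] p by (auto simp: star_def)
    then have "x \<notin> A \<phi>" using p q reachable.step[of G "A \<phi>" u q x p] by (auto simp: K_def)
    then show ?thesis using p by (auto simp: T_def A_def star_def swap_colours_def)
  qed (use p in \<open>auto simp: T_def star_def\<close>)
  \<comment> \<open>The swap preserves the set of edges coloured \<open>a\<close> or
    \<open>b\<close>, hence the chain itself, which is why \<open>T\<close> undoes itself.\<close>
  have "A (T \<phi>) = A \<phi>" for \<phi>
    using swap_colours_in_iff[of a b] by (auto simp: A_def T_def)
  then have KT: "K (T \<phi>) = K \<phi>" for \<phi> by (simp add: K_def)
  have T_edge: "T \<phi> x = (if ends G x \<inter> K \<phi> \<noteq> {} then swap_colours a b (\<phi> x) else \<phi> x)"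
    if "x \<in> edges G" for \<phi> x using that by (simp add: T_def)
  have TT: "T (T \<phi>) = \<phi>" if \<phi>: "\<phi> \<in> extensional (edges G)" for \<phi>
  proof (rule extensionalityI[OF _ \<phi>])
    show "T (T \<phi>) \<in> extensional (edges G)" by (simp add: T_def[of "T \<phi>"])
    show "T (T \<phi>) x = \<phi> x" if "x \<in> edges G" for x
      using that by (simp add: T_edge KT swap_colours_involutive)
  qed
  have T_flow: "T \<phi> \<in> flows G e" if \<phi>: "\<phi> \<in> flows G e" for \<phi>
  proof -
    have "T \<phi> x = 0 \<longleftrightarrow> x = e" if "x \<in> edges G" for x
      using \<phi> that by (auto simp: T_def flows_def swap_colours_eq_0_iff ab)
    moreover have "sum (T \<phi>) (star G p) = 0" if p: "p \<in> verts G" for p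
    proof (cases "p \<in> K \<phi>")
      case True
      have "sum (T \<phi>) (star G p) = swap_colours a b (sum \<phi> (star G p))"
        using T_in[OF True] by (simp add: swap_colours_sum ab)
      then show ?thesis using \<phi> p ab by (auto simp: flows_def)
    next
      case False
      then have "sum (T \<phi>) (star G p) = sum \<phi> (star G p)" using T_out by (intro sum.cong) auto
      then show ?thesis using \<phi> p by (auto simp: flows_def)
    qed
    ultimately show ?thesis by (auto simp: flows_def T_def)
  qed
  show ?thesis
  proof (rule card_inj_on_le[of T])
    show "inj_on T {\<phi> \<in> flows G e. \<phi> f = a \<and> \<phi> g = c}"
      by (rule inj_on_inverseI[of _ T]) (auto simp: flows_def intro: TT)
    show "T ` {\<phi> \<in> flows G e. \<phi> f = a \<and> \<phi> g = c} \<subseteq> {\<phi> \<in> flows G e. \<phi> f = b \<and> \<phi> g = c}"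
    proof clarify
      fix \<phi> assume \<phi>: "\<phi> \<in> flows G e" "a = \<phi> f" "c = \<phi> g"
      have "v \<notin> K \<phi>" using Kempe_chain_avoids[OF nc e ab \<phi>(1)] by (simp add: K_def A_def)
      then have "T \<phi> g = \<phi> g" by (rule T_out[OF _ g])
      moreover have "T \<phi> f = b" using T_in[OF uK f, of \<phi>] \<phi>(2) swap_colours_left by metis
      ultimately show "T \<phi> \<in> flows G e \<and> T \<phi> f = b \<and> T \<phi> g = \<phi> g" using T_flow \<phi> by blast
    qed
    show "finite {\<phi> \<in> flows G e. \<phi> f = b \<and> \<phi> g = c}"
      using finite_flows[OF finite_edges] by simp
  qed
qed

text \<open>Choose one further edge at each end of \<open>e\<close>. Kempe swaps from either end
  show that all nine pairs of nonzero values on these two edges belong to equally many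
  flows.\<close>

lemma card_flows_multiple_of_9:
  assumes nc: "\<not> edge_colourable3 G" and e: "e \<in> edges G"
  shows "9 dvd card (flows G e)"
proof -
  obtain u v where uv: "ends G e = {u, v}" using card_ends[OF e] by (auto simp: card_2_iff)
  have ex: "\<exists>f. f \<in> star G w \<and> f \<noteq> e" if "w \<in> ends G e" for w
  proof -
    have "card (star G w - {e}) = 2"
      using card_star[of w] ends_subset[OF e] e that by (auto simp: star_def)
    then show ?thesis by (metis Diff_iff card.empty ex_in_conv insertI1 zero_neq_numeral)
  qed
  obtain f where f: "f \<in> star G u" "f \<noteq> e" using ex uv by auto
  obtain g where g: "g \<in> star G v" "g \<noteq> e" using ex uv by auto
  define N where "N a b = card {\<phi> \<in> flows G e. \<phi> f = a \<and> \<phi> g = b}" for a b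
  have N1: "N a c = N b c" if "a \<noteq> 0" "b \<noteq> 0" for a b c
    using card_flows_Kempe_le[OF nc e uv _ _ _ f(1) g(1), of a b c]
      card_flows_Kempe_le[OF nc e uv _ _ _ f(1) g(1), of b a c] that
    by (cases "a = b") (auto simp: N_def)
  \<comment> \<open>Exchanging the two ends of \<open>e\<close> starts the Kempe chains at
    \<open>v\<close> and varies the value on \<open>g\<close>.\<close>
  have vu: "ends G e = {v, u}" using uv by auto
  have N2: "N c a = N c b" if "a \<noteq> 0" "b \<noteq> 0" for a b c
    using card_flows_Kempe_le[OF nc e vu _ _ _ g(1) f(1), of a b c]
      card_flows_Kempe_le[OF nc e vu _ _ _ g(1) f(1), of b a c] that
    by (cases "a = b") (auto simp: N_def conj_commute)
  let ?S = "{k :: klein. k \<noteq> 0}"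
  have "flows G e = (\<Union>p\<in>?S \<times> ?S. {\<phi> \<in> flows G e. \<phi> f = fst p \<and> \<phi> g = snd p})"
    using f g by (auto simp: flows_def star_def)
  also have "card \<dots> = (\<Sum>p\<in>?S \<times> ?S. N (fst p) (snd p))"
    unfolding N_def by (rule card_UN_disjoint) (use finite_flows[OF finite_edges] in auto)
  also have "\<dots> = (\<Sum>p\<in>?S \<times> ?S. N K1 K1)"
  proof (rule sum.cong)
    fix p assume "p \<in> ?S \<times> ?S"
    then show "N (fst p) (snd p) = N K1 K1"
      using N1[of "fst p" K1 "snd p"] N2[of "snd p" K1 K1] by (auto simp: zero_klein_def)
  qed simp
  also have "\<dots> = 9 * N K1 K1" by (simp add: card_cartesian_product card_nonzero_klein)
  finally show ?thesis by simp
qed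

end

section \<open>Counting the flows of the gadget\<close>

text \<open>Nowhere-zero fillings of the edges in \<open>B\<close>, where \<open>r t\<close> is the
  sum already contributed at \<open>t\<close> by edges outside \<open>B\<close>. The incidence
  \<open>inc\<close> is kept apart from any graph, so that edges can be removed one at a
  time.\<close>

definition solutions :: "('x \<Rightarrow> 't set) \<Rightarrow> 'x set \<Rightarrow> ('t \<Rightarrow> klein) \<Rightarrow> ('x \<Rightarrow> klein) set" where
  "solutions inc B r = {\<tau> \<in> extensional B.
     (\<forall>x\<in>B. \<tau> x \<noteq> 0) \<and> (\<forall>t. r t + sum \<tau> {x \<in> B. t \<in> inc x} = 0)}"

lemma finite_solutions: "finite B \<Longrightarrow> finite (solutions inc B r)"
  by (rule finite_subset[OF _ finite_extensional_klein[of B]]) (auto simp: solutions_def)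

text \<open>The parity argument: summed over all vertices, each edge value occurs twice and cancels,
  so only the residues remain.\<close>

lemma solutions_sum_zero:
  fixes r :: "'t::finite \<Rightarrow> klein"
  assumes "finite B" and card2: "\<And>x. x \<in> B \<Longrightarrow> card (inc x) = 2" and "\<tau> \<in> solutions inc B r"
  shows "sum r UNIV = 0"
proof -
  have "(\<Sum>t\<in>UNIV. sum \<tau> {x \<in> B. t \<in> inc x}) = (\<Sum>x\<in>B. \<Sum>t\<in>inc x. \<tau> x)"
    using sum.swap_restrict[OF finite_UNIV assms(1), of "\<lambda>_ x. \<tau> x" "\<lambda>t x. t \<in> inc x"] by simp
  also have "\<dots> = 0"
  proof (rule sum.neutral, rule ballI)
    fix x assume "x \<in> B"
    then obtain p q where "inc x = {p, q}" "p \<noteq> q" using card2 by (meson card_2_iff)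
    then show "(\<Sum>t\<in>inc x. \<tau> x) = 0" by simp
  qed
  finally have "sum r UNIV = (\<Sum>t\<in>UNIV. r t + sum \<tau> {x \<in> B. t \<in> inc x})" by (simp add: sum.distrib)
  also have "\<dots> = 0" using assms(3) by (simp add: solutions_def)
  finally show ?thesis .
qed

text \<open>The branching rule of the enumeration: fix the value \<open>k\<close> of
  \<open>x\<close> and charge it to the residues at the ends of \<open>x\<close>.\<close>

lemma card_solutions_insert:
  assumes B: "finite B" "x \<notin> B"
  shows "card (solutions inc (insert x B) r)
    = (\<Sum>k\<in>{K1, K2, K3}. card (solutions inc B (\<lambda>t. if t \<in> inc x then r t + k else r t)))"
proof -
  let ?r = "\<lambda>k t. if t \<in> inc x then r t + k else r t"
  let ?S = "Sigma {K1, K2, K3} (\<lambda>k. solutions inc B (?r k))"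
  have star: "sum \<tau> {y \<in> insert x B. t \<in> inc y}
    = (if t \<in> inc x then \<tau> x else 0) + sum \<tau> {y \<in> B. t \<in> inc y}" for \<tau> :: "_ \<Rightarrow> klein" and t
  proof -
    have "{y \<in> insert x B. t \<in> inc y}
      = (if t \<in> inc x then insert x {y \<in> B. t \<in> inc y} else {y \<in> B. t \<in> inc y})" by auto
    then show ?thesis using B by simp
  qed
  have cong: "sum (\<tau>(x := k)) {y \<in> B. t \<in> inc y} = sum \<tau> {y \<in> B. t \<in> inc y}"
    "sum (restrict \<tau> B) {y \<in> B. t \<in> inc y} = sum \<tau> {y \<in> B. t \<in> inc y}" for \<tau> :: "_ \<Rightarrow> klein" and k t
    using B by (auto intro!: sum.cong)
  have vertex: "r t + ((if t \<in> inc x then k else 0) + s) = ?r k t + s" for t k s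
    by (simp add: add.assoc)
  have "bij_betw (\<lambda>\<tau>. (\<tau> x, restrict \<tau> B)) (solutions inc (insert x B) r) ?S"
  proof (rule bij_betw_byWitness[where f' = "\<lambda>(k, \<tau>). \<tau>(x := k)"])
    show "\<forall>\<tau>\<in>solutions inc (insert x B) r. (\<lambda>(k, \<tau>). \<tau>(x := k)) (\<tau> x, restrict \<tau> B) = \<tau>"
      by (auto simp: solutions_def extensional_def fun_eq_iff)
    show "\<forall>p\<in>?S. (\<lambda>\<tau>. (\<tau> x, restrict \<tau> B)) ((\<lambda>(k, \<tau>). \<tau>(x := k)) p) = p"
      using B by (auto simp: solutions_def extensional_def fun_eq_iff restrict_def)
    show "(\<lambda>\<tau>. (\<tau> x, restrict \<tau> B)) ` solutions inc (insert x B) r \<subseteq> ?S"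
    proof (rule image_subsetI)
      fix \<tau> assume \<tau>: "\<tau> \<in> solutions inc (insert x B) r"
      then have "\<tau> x \<in> {k. k \<noteq> 0}" by (simp add: solutions_def)
      moreover have "?r (\<tau> x) t + sum (restrict \<tau> B) {y \<in> B. t \<in> inc y} = 0" for t
        using \<tau> unfolding solutions_def star cong vertex by blast
      ultimately show "(\<tau> x, restrict \<tau> B) \<in> ?S"
        using \<tau> unfolding nonzero_klein by (auto simp: solutions_def)
    qed
    show "(\<lambda>(k, \<tau>). \<tau>(x := k)) ` ?S \<subseteq> solutions inc (insert x B) r"
    proof (rule image_subsetI)
      fix p assume p: "p \<in> ?S"
      obtain k \<tau> where [simp]: "p = (k, \<tau>)" by (cases p)
      have k: "k \<in> {k. k \<noteq> 0}" and \<tau>: "\<tau> \<in> solutions inc B (?r k)"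
        using p unfolding nonzero_klein by auto
      have "r t + sum (\<tau>(x := k)) {y \<in> insert x B. t \<in> inc y} = 0" for t
        using \<tau> unfolding solutions_def star cong fun_upd_same vertex by blast
      moreover have "\<tau>(x := k) \<in> extensional (insert x B)" "\<forall>y\<in>insert x B. (\<tau>(x := k)) y \<noteq> 0"
        using k \<tau> by (auto simp: solutions_def extensional_def)
      ultimately show "(\<lambda>(k, \<tau>). \<tau>(x := k)) p \<in> solutions inc (insert x B) r"
        by (simp add: solutions_def)
    qed
  qed
  then have "card (solutions inc (insert x B) r) = card ?S" by (rule bij_betw_same_card)
  also have "\<dots> = (\<Sum>k\<in>{K1, K2, K3}. card (solutions inc B (?r k)))"
    by (rule card_SigmaI) (use finite_solutions[OF B(1)] in auto)
  finally show ?thesis .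
qed

section \<open>Executable counting of solutions, with residues stored in association lists\<close>

fun bump :: "'t \<Rightarrow> klein \<Rightarrow> ('t \<times> klein) list \<Rightarrow> ('t \<times> klein) list" where
  "bump t k [] = []"
| "bump t k ((s, l) # r) = (if s = t then (s, l + k) # r else (s, l) # bump t k r)"

definition touches :: "('t \<times> 't) list \<Rightarrow> 't \<Rightarrow> bool" where
  "touches es t \<longleftrightarrow> t \<in> fst ` set es \<union> snd ` set es"

text \<open>The flags record whether an end of the edge still has an edge to come. If not, its residue is
  final and a nonzero value prunes the search.\<close>

fun mark :: "('t \<times> 't) list \<Rightarrow> ('t \<times> bool \<times> 't \<times> bool) list" where
  "mark [] = []"
| "mark ((s, t) # es) = (s, touches es s, t, touches es t) # mark es"

fun settled :: "('t \<times> klein) list \<Rightarrow> bool \<Rightarrow> 't \<Rightarrow> bool" where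
  "settled r True t = True"
| "settled r False t = (map_of r t = Some 0)"

text \<open>A backtracking search. A leaf counts 1 without any further test, because the residue of
  each vertex is tested when its last edge is coloured.\<close>

fun count_solutions :: "('t \<times> bool \<times> 't \<times> bool) list \<Rightarrow> ('t \<times> klein) list \<Rightarrow> nat" where
  "count_solutions [] r = 1"
| "count_solutions ((s, p, t, q) # es) r = (
    let f = (\<lambda>k. let r' = bump s k (bump t k r) in
      if settled r' p s then if settled r' q t then count_solutions es r' else 0 else 0)
    in f K1 + f K2 + f K3)"

lemma map_of_bump:
  "map_of (bump t k r) s = (if s = t then map_option (\<lambda>l. l + k) (map_of r s) else map_of r s)"
  by (induction t k r rule: bump.induct) auto

lemma settled_iff: "settled r p t \<longleftrightarrow> p \<or> map_of r t = Some 0"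
  by (cases p) auto

text \<open>The last assumption is the invariant of the search: a vertex with no edge to come has
  residue 0. A branch that breaks it has no solutions, and at a leaf it makes the empty filling the
  only solution. \<open>nm\<close> translates listed pairs into edges.\<close>

lemma count_solutions_correct:
  assumes "distinct es" and "inj_on nm (set es)"
    and "\<And>s t. (s, t) \<in> set es \<Longrightarrow> s \<noteq> t \<and> inc (nm (s, t)) = {s, t}"
    and "\<And>t. map_of r t \<noteq> None" and "\<And>t. touches es t \<or> map_of r t = Some 0"
  shows "count_solutions (mark es) r = card (solutions inc (nm ` set es) (\<lambda>t. the (map_of r t)))"
  using assms
proof (induction es arbitrary: r)
  case Nil
  have "the (map_of r t) = 0" for t using Nil(5)[of t] by (simp add: touches_def)
  then have "solutions inc (nm ` set []) (\<lambda>t. the (map_of r t)) = {\<lambda>_. undefined}"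
    by (auto simp: solutions_def)
  then show ?case by simp
next
  case (Cons e es)
  obtain s t where e: "e = (s, t)" by (cases e)
  have st: "s \<noteq> t" "inc (nm e) = {s, t}" using Cons.prems(3)[of s t] e by auto
  define r' where "r' k = bump s k (bump t k r)" for k
  let ?B = "nm ` set es"
  have r'_None: "map_of (r' k) v \<noteq> None" for k v
    using Cons.prems(4)[of v] by (auto simp: r'_def map_of_bump)
  have r': "(\<lambda>v. if v \<in> inc (nm e) then the (map_of r v) + k else the (map_of r v)) = (\<lambda>v. the (map_of (r' k) v))" for k
    using Cons.prems(4) st by (auto simp: r'_def map_of_bump fun_eq_iff option.map_sel)
  have step: "(if settled (r' k) (touches es s) s then
        if settled (r' k) (touches es t) t then count_solutions (mark es) (r' k) else 0 else 0)
      = card (solutions inc ?B (\<lambda>v. the (map_of (r' k) v)))" for k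
  proof (cases "settled (r' k) (touches es s) s \<and> settled (r' k) (touches es t) t")
    case True
    have "touches es v \<or> map_of (r' k) v = Some 0" for v
    proof (cases "v = s \<or> v = t")
      case False
      then have "map_of (r' k) v = map_of r v" "touches (e # es) v = touches es v"
        by (auto simp: r'_def map_of_bump touches_def e)
      then show ?thesis using Cons.prems(5)[of v] by simp
    qed (use True in \<open>auto simp: settled_iff\<close>)
    then have "count_solutions (mark es) (r' k) = card (solutions inc ?B (\<lambda>v. the (map_of (r' k) v)))"
      using Cons.prems(1-3) r'_None by (intro Cons.IH) (auto simp: inj_on_insert)
    then show ?thesis using True by simp
  next
    \<comment> \<open>A pruned branch: no remaining edge touches \<open>v\<close>, so its nonzero
      residue can never be cancelled.\<close>
    case False
    then obtain v where v: "\<not> touches es v" "map_of (r' k) v \<noteq> Some 0"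
      by (auto simp: settled_iff)
    then have nz: "the (map_of (r' k) v) \<noteq> 0" using r'_None[of k v] by auto
    have "v \<notin> inc x" if x: "x \<in> ?B" for x
    proof -
      obtain p q where "(p, q) \<in> set es" "x = nm (p, q)" using x by auto
      then show ?thesis using v(1) Cons.prems(3)[of p q] by (force simp: touches_def)
    qed
    then have "{x \<in> ?B. v \<in> inc x} = {}" by blast
    then have "the (map_of (r' k) v) + sum \<tau> {x \<in> ?B. v \<in> inc x} \<noteq> 0" for \<tau> using nz by (metis add.right_neutral sum.empty)
    then have "solutions inc ?B (\<lambda>v. the (map_of (r' k) v)) = {}"
      unfolding solutions_def by blast
    then show ?thesis using False by auto
  qed
  have "nm e \<notin> ?B" using Cons.prems(1,2) by (auto simp: inj_on_insert)
  then have "card (solutions inc (insert (nm e) ?B) (\<lambda>v. the (map_of r v)))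
    = (\<Sum>k\<in>{K1, K2, K3}. card (solutions inc ?B (\<lambda>v. the (map_of (r' k) v))))"
    unfolding r'[symmetric] by (intro card_solutions_insert) auto
  also have "\<dots> = count_solutions (mark (e # es)) r"
    by (simp add: e Let_def step[symmetric]) (simp add: r'_def)
  finally show ?case by simp
qed

text \<open>The order completes vertices early (\<open>Tb\<close> after two edges, \<open>Tc\<close>
  after four, \<open>Th\<close> after five), so that wrong branches are cut off soon.\<close>

definition T_list :: "(tvert \<times> tvert) list" where
  "T_list = [(Tb, Th), (Tb, Ts1), (Th, Tc), (Tc, Ti), (Th, Ts2), (Ti, Td), (Td, Tt2), (Ti, Tt1),
     (Ta, Tf), (Ta, Ts3), (Tf, Tk), (Tf, Ts4), (Ts1, Ts4), (Ts4, Ts2), (Ts2, Ts3), (Ts3, Tg), (Tg, Ts1),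
     (Tg, Tj), (Tk, Te), (Te, Tt3), (Tk, Tt4), (Tj, Tt3), (Tt3, Tt1), (Tt1, Tt4), (Tt4, Tt2), (Tt2, Tj)]"

definition T_residue :: "klein \<Rightarrow> klein \<Rightarrow> klein \<Rightarrow> klein \<Rightarrow> klein \<Rightarrow> (tvert \<times> klein) list" where
  "T_residue a b c d e = [(Tb, b), (Th, 0), (Ts1, 0), (Tc, c), (Ti, 0), (Ts2, 0), (Td, d), (Tt2, 0),
     (Tt1, 0), (Ta, a), (Tf, 0), (Ts3, 0), (Tk, 0), (Ts4, 0), (Tg, 0), (Tj, 0), (Te, e), (Tt3, 0), (Tt4, 0)]"

lemma T_edges_eq: "T_edges = (\<lambda>(s, t). {s, t}) ` set T_list"
  by code_simp

lemma T_list_distinct: "distinct (map (\<lambda>(s, t). {s, t}) T_list)"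
  by code_simp

lemma UNIV_tvert: "(UNIV :: tvert set) = {Ta, Tb, Tc, Td, Te, Tf, Tg, Th, Ti, Tj, Tk,
    Ts1, Ts2, Ts3, Ts4, Tt1, Tt2, Tt3, Tt4}"
  using tvert.exhaust by auto

instance tvert :: finite
  by standard (simp add: UNIV_tvert)

text \<open>By parity the fifth value is forced to be \<open>a + b + c + d\<close>. The cases with
  count 0 are those in which the path \<open>u2\<close>, \<open>u3\<close>, \<open>u4\<close> admits
  no filling either.\<close>

definition T_count_ok :: "klein \<Rightarrow> klein \<Rightarrow> klein \<Rightarrow> klein \<Rightarrow> bool" where
  "T_count_ok a b c d \<longleftrightarrow> (let e = a + b + c + d in if e = 0 then True else
     count_solutions (mark T_list) (T_residue a b c d e) = (if a = b then 0 else if d = e then 0 else 5))"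

definition T_counts_ok :: "klein \<Rightarrow> klein \<Rightarrow> bool" where
  "T_counts_ok a b \<longleftrightarrow> list_all (\<lambda>c. list_all (T_count_ok a b c) [K1, K2, K3]) [K1, K2, K3]"

text \<open>The enumeration itself: all 81 choices of nonzero \<open>a\<close>, \<open>b\<close>,
  \<open>c\<close>, \<open>d\<close>, evaluated in nine blocks.\<close>

lemma T_counts:
  "T_counts_ok K1 K1" "T_counts_ok K1 K2" "T_counts_ok K1 K3"
  "T_counts_ok K2 K1" "T_counts_ok K2 K2" "T_counts_ok K2 K3"
  "T_counts_ok K3 K1" "T_counts_ok K3 K2" "T_counts_ok K3 K3"
  by code_simp+

definition gadget_ends :: "'e sup_edge \<Rightarrow> tvert set" where
  "gadget_ends y = (case y of Gadget X \<Rightarrow> X | _ \<Rightarrow> {})"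

definition boundary :: "klein \<Rightarrow> klein \<Rightarrow> klein \<Rightarrow> klein \<Rightarrow> klein \<Rightarrow> tvert \<Rightarrow> klein" where
  "boundary a b c d e t = (case t of Ta \<Rightarrow> a | Tb \<Rightarrow> b | Tc \<Rightarrow> c | Td \<Rightarrow> d | Te \<Rightarrow> e | _ \<Rightarrow> 0)"

lemma T_residue_boundary: "map_of (T_residue a b c d e) t = Some (boundary a b c d e t)"
  by (cases t) (simp_all add: T_residue_def boundary_def)

text \<open>If the five boundary values sum to 0, the enumeration gives the count; otherwise parity
  rules out every filling.\<close>

lemma card_gadget_solutions:
  assumes nz: "a \<noteq> 0" "b \<noteq> 0" "c \<noteq> 0" "d \<noteq> 0" "e \<noteq> 0"
  shows "card (solutions gadget_ends (Gadget ` T_edges :: 'e sup_edge set) (boundary a b c d e))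
    = (if a \<noteq> b \<and> d \<noteq> e \<and> a + b + c + d + e = 0 then 5 else 0)"
proof (cases "a + b + c + d + e = 0")
  case True
  let ?nm = "\<lambda>(s, t). Gadget {s, t} :: 'e sup_edge"
  have nm: "?nm ` set T_list = Gadget ` T_edges"
    unfolding T_edges_eq image_image by (intro image_cong) auto
  have inj: "inj_on (\<lambda>(s, t). {s, t}) (set T_list)" and dist: "distinct T_list"
    using T_list_distinct by (simp_all add: distinct_map)
  have "count_solutions (mark T_list) (T_residue a b c d e)
      = card (solutions gadget_ends (?nm ` set T_list) (\<lambda>t. the (map_of (T_residue a b c d e) t)))"
  proof (rule count_solutions_correct[OF dist])
    show "inj_on ?nm (set T_list)" using inj by (auto simp: inj_on_def)
    show "s \<noteq> t \<and> gadget_ends (?nm (s, t)) = {s, t}" if "(s, t) \<in> set T_list" for s t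
      using that by (auto simp: T_list_def gadget_ends_def)
    show "touches T_list t \<or> map_of (T_residue a b c d e) t = Some 0" for t
      by (cases t) (simp_all add: touches_def T_list_def)
  qed (simp add: T_residue_boundary)
  then have "card (solutions gadget_ends (Gadget ` T_edges :: 'e sup_edge set) (boundary a b c d e))
      = count_solutions (mark T_list) (T_residue a b c d e)"
    by (simp add: nm T_residue_boundary)
  moreover have "T_count_ok a b c d"
  proof -
    have "k = K1 \<or> k = K2 \<or> k = K3" if "k \<noteq> 0" for k using that by (cases k) (auto simp: zero_klein_def)
    then have "T_counts_ok a b" "c \<in> {K1, K2, K3}" "d \<in> {K1, K2, K3}"
      using nz T_counts by (metis, blast, blast)
    then show ?thesis by (auto simp: T_counts_ok_def)
  qed
  moreover have "e = a + b + c + d" using True by (simp add: klein_add_eq_0_iff)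
  ultimately show ?thesis using True nz(5) by (simp add: T_count_ok_def Let_def)
next
  case False
  have "sum (boundary a b c d e) UNIV = a + b + c + d + e"
    by (simp add: UNIV_tvert boundary_def ac_simps)
  moreover have "card (gadget_ends x) = 2" if "x \<in> Gadget ` T_edges" for x :: "'e sup_edge"
    using that by (auto simp: T_edges_def gadget_ends_def)
  moreover have "finite (Gadget ` T_edges)" by (simp add: T_edges_def)
  ultimately have "solutions gadget_ends (Gadget ` T_edges :: 'e sup_edge set) (boundary a b c d e) = {}"
    using False solutions_sum_zero by (metis ex_in_conv)
  then show ?thesis using False by simp
qed

section \<open>Splitting flows along a cut\<close>

definition outer_flows :: "('v, 'e) ugraph \<Rightarrow> 'e \<Rightarrow> 'e set \<Rightarrow> 'v set \<Rightarrow> ('e \<Rightarrow> klein) set" where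
  "outer_flows G e A V = {\<phi> \<in> extensional A.
     (\<forall>x\<in>A. \<phi> x = 0 \<longleftrightarrow> x = e) \<and> (\<forall>v\<in>V. sum \<phi> (star G v) = 0)}"

text \<open>The edges of the cut belong to \<open>A\<close> and enter as constants through
  \<open>\<phi>\<close>. All inner values must be nonzero, since the exceptional edge is taken from
  \<open>A\<close>.\<close>

definition inner_flows :: "('v, 'e) ugraph \<Rightarrow> 'e set \<Rightarrow> 'v set \<Rightarrow> ('e \<Rightarrow> klein) \<Rightarrow> ('e \<Rightarrow> klein) set" where
  "inner_flows G A V \<phi> = {\<tau> \<in> extensional (edges G - A). (\<forall>x\<in>edges G - A. \<tau> x \<noteq> 0) \<and>
     (\<forall>v\<in>verts G - V. sum \<phi> (star G v \<inter> A) + sum \<tau> (star G v - A) = 0)}"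

text \<open>Restriction to \<open>A\<close> and to its complement is a bijection onto compatible
  pairs: sums at vertices of \<open>V\<close> involve \<open>A\<close> only, and the other vertices
  give the conditions on the inner part.\<close>

lemma card_flows_split:
  assumes fin: "finite (edges G)" and A: "A \<subseteq> edges G" "e \<in> A" and V: "V \<subseteq> verts G"
    and star_V: "\<And>v. v \<in> V \<Longrightarrow> star G v \<subseteq> A"
  shows "card (flows G e) = (\<Sum>\<phi>\<in>outer_flows G e A V. card (inner_flows G A V \<phi>))"
proof -
  let ?S = "Sigma (outer_flows G e A V) (inner_flows G A V)"
  let ?glue = "\<lambda>(\<phi>, \<tau>). \<lambda>x\<in>edges G. if x \<in> A then \<phi> x else \<tau> x"
  have fin_star: "finite (star G v)" for v using fin by (simp add: star_def)
  have split: "sum \<psi> (star G v) = sum \<psi> (star G v \<inter> A) + sum \<psi> (star G v - A)" for \<psi> :: "_ \<Rightarrow> klein" and v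
    by (rule sum.Int_Diff[OF fin_star])
  have "bij_betw (\<lambda>\<psi>. (restrict \<psi> A, restrict \<psi> (edges G - A))) (flows G e) ?S"
  proof (rule bij_betw_byWitness[where f' = ?glue])
    show "\<forall>\<psi>\<in>flows G e. ?glue (restrict \<psi> A, restrict \<psi> (edges G - A)) = \<psi>"
      by (auto simp: flows_def extensional_def fun_eq_iff)
    show "\<forall>p\<in>?S. (\<lambda>\<psi>. (restrict \<psi> A, restrict \<psi> (edges G - A))) (?glue p) = p"
      using A by (auto simp: outer_flows_def inner_flows_def extensional_def fun_eq_iff)
    show "(\<lambda>\<psi>. (restrict \<psi> A, restrict \<psi> (edges G - A))) ` flows G e \<subseteq> ?S"
    proof (rule image_subsetI)
      fix \<psi> assume \<psi>: "\<psi> \<in> flows G e"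
      have "sum (restrict \<psi> A) (star G v) = sum \<psi> (star G v)" if "v \<in> V" for v
        using star_V[OF that] by (intro sum.cong) auto
      then have "restrict \<psi> A \<in> outer_flows G e A V"
        using \<psi> A V by (auto simp: flows_def outer_flows_def)
      moreover have "sum (restrict \<psi> A) (star G v \<inter> A) = sum \<psi> (star G v \<inter> A)"
        "sum (restrict \<psi> (edges G - A)) (star G v - A) = sum \<psi> (star G v - A)" for v
        by (auto intro!: sum.cong simp: star_def)
      then have "restrict \<psi> (edges G - A) \<in> inner_flows G A V (restrict \<psi> A)"
        using \<psi> A by (auto simp: flows_def inner_flows_def split[symmetric])
      ultimately show "(restrict \<psi> A, restrict \<psi> (edges G - A)) \<in> ?S" by simp
    qed
    show "?glue ` ?S \<subseteq> flows G e"
    proof (rule image_subsetI)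
      fix p assume p: "p \<in> ?S"
      obtain \<phi> \<tau> where [simp]: "p = (\<phi>, \<tau>)" by (cases p)
      have \<phi>: "\<phi> \<in> outer_flows G e A V" and \<tau>: "\<tau> \<in> inner_flows G A V \<phi>" using p by auto
      have "sum (?glue p) (star G v) = 0" if v: "v \<in> verts G" for v
      proof (cases "v \<in> V")
        case True
        then have "sum (?glue p) (star G v) = sum \<phi> (star G v)"
          using star_V[OF True] A by (intro sum.cong) auto
        then show ?thesis using \<phi> True by (simp add: outer_flows_def)
      next
        case False
        have "sum (?glue p) (star G v \<inter> A) = sum \<phi> (star G v \<inter> A)"
          "sum (?glue p) (star G v - A) = sum \<tau> (star G v - A)"
          by (auto intro!: sum.cong simp: star_def)
        then show ?thesis using \<tau> v False split[of "?glue p" v] by (simp add: inner_flows_def)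
      qed
      moreover have "?glue p x = 0 \<longleftrightarrow> x = e" if "x \<in> edges G" for x
        using that \<phi> \<tau> A by (auto simp: outer_flows_def inner_flows_def)
      ultimately show "?glue p \<in> flows G e" by (auto simp: flows_def)
    qed
  qed
  then have "card (flows G e) = card ?S" by (rule bij_betw_same_card)
  also have "\<dots> = (\<Sum>\<phi>\<in>outer_flows G e A V. card (inner_flows G A V \<phi>))"
  proof (rule card_SigmaI)
    show "finite (outer_flows G e A V)"
      by (rule finite_subset[OF _ finite_extensional_klein[of A]])
        (use fin A finite_subset in \<open>auto simp: outer_flows_def\<close>)
    show "\<forall>\<phi>\<in>outer_flows G e A V. finite (inner_flows G A V \<phi>)"
      by (intro ballI, rule finite_subset[OF _ finite_extensional_klein[of "edges G - A"]])
        (use fin in \<open>auto simp: inner_flows_def\<close>)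
  qed
  finally show ?thesis .
qed

text \<open>Carries outer flows over when the outsides of two graphs agree, with edges matched by
  \<open>m\<close> and vertices by \<open>n\<close>; the parts beyond the cuts may differ.\<close>

lemma bij_betw_outer_flows:
  assumes m: "bij_betw m B A" and e: "e' \<in> B" "m e' = e"
    and star_W: "\<And>w. w \<in> W \<Longrightarrow> star H w \<subseteq> B"
    and star_V: "\<And>v. v \<in> V \<Longrightarrow> star G v \<subseteq> A"
    and n: "n ` V = W" and m_star: "\<And>v. v \<in> V \<Longrightarrow> m ` star H (n v) = star G v"
  shows "bij_betw (\<lambda>\<phi>. \<lambda>y\<in>B. \<phi> (m y)) (outer_flows G e A V) (outer_flows H e' B W)"
proof (rule bij_betw_byWitness[where f' = "\<lambda>\<psi>. \<lambda>x\<in>A. \<psi> (inv_into B m x)"])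
  have inv: "inv_into B m (m y) = y" if "y \<in> B" for y
    by (rule bij_betw_inv_into_left[OF m that])
  have inv': "m (inv_into B m x) = x" "inv_into B m x \<in> B" if "x \<in> A" for x
    using bij_betw_inv_into_right[OF m that] bij_betwE[OF bij_betw_inv_into[OF m]] that by blast+
  have mA: "m y \<in> A" if "y \<in> B" for y using bij_betwE[OF m] that by blast
  have star_sum: "sum \<psi> (star H (n v)) = sum \<phi> (star G v)"
    if "v \<in> V" "\<And>y. y \<in> star H (n v) \<Longrightarrow> \<psi> y = \<phi> (m y)" for \<phi> \<psi> :: "_ \<Rightarrow> klein" and v
  proof -
    have "star H (n v) \<subseteq> B" using n that(1) by (intro star_W) blast
    then have "inj_on m (star H (n v))" using bij_betw_imp_inj_on[OF m] inj_on_subset by blast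
    then show ?thesis using that(2) by (simp add: m_star[OF that(1), symmetric] sum.reindex)
  qed
  show "\<forall>\<phi>\<in>outer_flows G e A V. (\<lambda>x\<in>A. (\<lambda>y\<in>B. \<phi> (m y)) (inv_into B m x)) = \<phi>"
    using inv' by (auto simp: outer_flows_def extensional_def fun_eq_iff)
  show "\<forall>\<psi>\<in>outer_flows H e' B W. (\<lambda>y\<in>B. (\<lambda>x\<in>A. \<psi> (inv_into B m x)) (m y)) = \<psi>"
    using inv mA by (auto simp: outer_flows_def extensional_def fun_eq_iff)
  show "(\<lambda>\<phi>. \<lambda>y\<in>B. \<phi> (m y)) ` outer_flows G e A V \<subseteq> outer_flows H e' B W"
  proof (rule image_subsetI)
    fix \<phi> assume \<phi>: "\<phi> \<in> outer_flows G e A V"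
    have "\<phi> (m y) = 0 \<longleftrightarrow> y = e'" if y: "y \<in> B" for y
    proof -
      have "\<phi> (m y) = 0 \<longleftrightarrow> m y = m e'" using \<phi> mA[OF y] e by (simp add: outer_flows_def)
      then show ?thesis using inv[OF y] inv[OF e(1)] by metis
    qed
    moreover have "sum (\<lambda>y\<in>B. \<phi> (m y)) (star H (n v)) = 0" if v: "v \<in> V" for v
    proof -
      have "star H (n v) \<subseteq> B" using v n by (intro star_W) blast
      then have "sum (\<lambda>y\<in>B. \<phi> (m y)) (star H (n v)) = sum \<phi> (star G v)"
        by (intro star_sum[OF v]) auto
      then show ?thesis using \<phi> v by (simp add: outer_flows_def)
    qed
    then have "\<forall>w\<in>W. sum (\<lambda>y\<in>B. \<phi> (m y)) (star H w) = 0" using n by blast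
    ultimately show "(\<lambda>y\<in>B. \<phi> (m y)) \<in> outer_flows H e' B W"
      by (simp add: outer_flows_def)
  qed
  show "(\<lambda>\<psi>. \<lambda>x\<in>A. \<psi> (inv_into B m x)) ` outer_flows H e' B W \<subseteq> outer_flows G e A V"
  proof (rule image_subsetI)
    fix \<psi> assume \<psi>: "\<psi> \<in> outer_flows H e' B W"
    have "\<psi> (inv_into B m x) = 0 \<longleftrightarrow> x = e" if x: "x \<in> A" for x
    proof -
      have "\<psi> (inv_into B m x) = 0 \<longleftrightarrow> inv_into B m x = e'"
        using \<psi> inv'[OF x] by (simp add: outer_flows_def)
      then show ?thesis using inv'[OF x] inv[OF e(1)] e by metis
    qed
    moreover have "sum (\<lambda>x\<in>A. \<psi> (inv_into B m x)) (star G v) = 0" if v: "v \<in> V" for v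
    proof -
      have B: "star H (n v) \<subseteq> B" using v n by (intro star_W) blast
      have "\<psi> y = (\<lambda>x\<in>A. \<psi> (inv_into B m x)) (m y)" if "y \<in> star H (n v)" for y
      proof -
        have "y \<in> B" using that B by blast
        then show ?thesis using mA inv by simp
      qed
      then have "sum \<psi> (star H (n v)) = sum (\<lambda>x\<in>A. \<psi> (inv_into B m x)) (star G v)"
        by (rule star_sum[OF v])
      moreover have "n v \<in> W" using v n by blast
      ultimately show ?thesis using \<psi> by (simp add: outer_flows_def)
    qed
    ultimately show "(\<lambda>x\<in>A. \<psi> (inv_into B m x)) \<in> outer_flows G e A V"
      by (simp add: outer_flows_def)
  qed
qed

section \<open>The number \<open>psi\<close> in terms of flows\<close>

lemma (in cubic_graph) psi_eq:
  assumes "e \<in> edges G" and "card (flows G e) = 18 * J"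
  shows "psi G e = J"
  unfolding psi_def using assms card_flows_eq_decompositions[OF assms(1)] by (intro the_equality) auto

text \<open>The number of flows is divisible by 9 through the Kempe chains and by 2 through the
  permutations of the colours, hence by 18.\<close>

lemma (in cubic_graph) psi_eq_flows:
  assumes "e \<in> edges G" and "\<not> edge_colourable3 G"
  shows "card (flows G e) = 18 * psi G e"
proof -
  obtain N where "card (flows G e) = 9 * N"
    using card_flows_multiple_of_9[OF assms(2,1)] by (auto simp: dvd_def)
  moreover have "even (card (flows G e))" using card_flows_eq_decompositions[OF assms(1)] by simp
  ultimately obtain J where "card (flows G e) = 18 * J" by (auto elim!: evenE)
  then show ?thesis using psi_eq[OF assms(1)] by simp
qed

lemma snark_cubic_graph:
  assumes "snark G"
  shows "cubic_graph G"
proof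
  have G: "graph G" "simple G" "cubic G" using assms by (auto simp: snark_def simple_def)
  show "finite (verts G)" "inj_on (ends G) (edges G)" using G by (auto simp: simple_def)
  show "ends G x \<subseteq> verts G" if "x \<in> edges G" for x using G that by (auto simp: graph_def)
  show card2: "card (ends G x) = 2" if "x \<in> edges G" for x
    using G that by (auto simp: graph_def simple_def)
  show "card (star G v) = 3" if "v \<in> verts G" for v
  proof -
    have no_loop: "{x \<in> edges G. ends G x = {v}} = {}" using card2 by force
    have "degree G v = 3" using G that by (simp add: cubic_def)
    then show ?thesis unfolding degree_def star_def no_loop by simp
  qed
qed

section \<open>Flows of the superposition\<close>

lemma card_T_star: "card {X \<in> T_edges. t \<in> X} = (if t \<in> {Ta, Tb, Tc, Td, Te} then 2 else 3)"
proof -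
  \<comment> \<open>\<open>Set.filter\<close> replaces the set comprehension by an executable
    form.\<close>
  have "list_all (\<lambda>t. card (Set.filter (\<lambda>X. t \<in> X) T_edges) = (if t \<in> {Ta, Tb, Tc, Td, Te} then 2 else 3))
    [Ta, Tb, Tc, Td, Te, Tf, Tg, Th, Ti, Tj, Tk, Ts1, Ts2, Ts3, Ts4, Tt1, Tt2, Tt3, Tt4]"
    by code_simp
  then show ?thesis by (cases t) (simp_all add: Set.filter_eq)
qed

lemma card_T_edge: "X \<in> T_edges \<Longrightarrow> card X = 2"
  by (auto simp: T_edges_def)

text \<open>The edges \<open>ea\<close> to \<open>ee\<close> leave the path \<open>u2\<close>,
  \<open>u3\<close>, \<open>u4\<close> and are lettered by the port of \<open>T\<close> that takes
  over their inner end; \<open>g1\<close> and \<open>g2\<close> are the two edges inside the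
  path.\<close>

locale superposed = cubic_graph G for G :: "('v, 'e) ugraph" +
  fixes u1 u2 u3 u4 u5 v2 v3 v4 :: 'v and ea eb ec ed ee g1 g2 F :: 'e
  assumes distinct_path: "distinct [u1, u2, u3, u4, u5]"
    and off_path: "{v2, v3, v4} \<inter> {u1, u2, u3, u4, u5} = {}"
    and in_edges: "{ea, eb, ec, ed, ee, g1, g2} \<subseteq> edges G"
    and ends_eqs: "ends G ea = {u1, u2}" "ends G eb = {u2, v2}" "ends G ec = {u3, v3}"
      "ends G ed = {u4, v4}" "ends G ee = {u4, u5}" "ends G g1 = {u2, u3}" "ends G g2 = {u3, u4}"
    and F: "F \<in> edges G" "F \<notin> {ea, eb, ec, ed, ee, g1, g2}"
begin

abbreviation "U \<equiv> {u2, u3, u4}"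
abbreviation "ports \<equiv> {Ta, Tb, Tc, Td, Te}"

definition superposed_graph :: "('v + tvert, 'e sup_edge) ugraph" where
  "superposed_graph = superposition G u1 u2 u3 u4 u5 v2 v3 v4"

section \<open>Matching the outside edges of both graphs\<close>

definition leg :: "tvert \<Rightarrow> 'e" where
  "leg t = (case t of Ta \<Rightarrow> ea | Tb \<Rightarrow> eb | Tc \<Rightarrow> ec | Td \<Rightarrow> ed | Te \<Rightarrow> ee | _ \<Rightarrow> undefined)"

text \<open>The five legs count as outside: they form the cut, and they correspond to the
  \<open>Link\<close> edges in \<open>outer\<close>.\<close>

definition kept :: "'e set" where "kept = edges G - {g1, g2}"

definition outer :: "'e sup_edge set" where
  "outer = Old ` {f \<in> edges G. ends G f \<inter> U = {}} \<union> Link ` ports"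

definition old :: "'e sup_edge \<Rightarrow> 'e" where
  "old y = (case y of Old f \<Rightarrow> f | Link t \<Rightarrow> leg t | _ \<Rightarrow> undefined)"

lemma old_simps [simp]: "old (Old f) = f" "old (Link t) = leg t"
  by (simp_all add: old_def)

lemma leg_simps [simp]: "leg Ta = ea" "leg Tb = eb" "leg Tc = ec" "leg Td = ed" "leg Te = ee"
  by (simp_all add: leg_def)

lemma path_neq: "u1 \<noteq> u2" "u1 \<noteq> u3" "u1 \<noteq> u4" "u1 \<noteq> u5" "u2 \<noteq> u3" "u2 \<noteq> u4" "u2 \<noteq> u5" "u3 \<noteq> u4" "u3 \<noteq> u5"
  "u4 \<noteq> u5" "v2 \<noteq> u1" "v2 \<noteq> u2" "v2 \<noteq> u3" "v2 \<noteq> u4" "v2 \<noteq> u5" "v3 \<noteq> u1" "v3 \<noteq> u2" "v3 \<noteq> u3" "v3 \<noteq> u4" "v3 \<noteq> u5"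
  "v4 \<noteq> u1" "v4 \<noteq> u2" "v4 \<noteq> u3" "v4 \<noteq> u4" "v4 \<noteq> u5"
  using distinct_path off_path by auto

lemmas path_neqs = path_neq path_neq[symmetric]

lemma edges_distinct: "distinct [ea, eb, ec, ed, ee, g1, g2]"
proof -
  have "distinct (map (ends G) [ea, eb, ec, ed, ee, g1, g2])"
    by (simp add: ends_eqs doubleton_eq_iff path_neqs)
  then show ?thesis by (simp only: distinct_map)
qed

lemma edge_in: "ea \<in> edges G" "eb \<in> edges G" "ec \<in> edges G" "ed \<in> edges G" "ee \<in> edges G"
  "g1 \<in> edges G" "g2 \<in> edges G"
  using in_edges by auto

lemma vert_in: "u1 \<in> verts G" "u2 \<in> verts G" "u3 \<in> verts G" "u4 \<in> verts G" "u5 \<in> verts G"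
  "v2 \<in> verts G" "v3 \<in> verts G" "v4 \<in> verts G"
  using ends_subset[OF edge_in(1)] ends_subset[OF edge_in(2)] ends_subset[OF edge_in(3)]
    ends_subset[OF edge_in(4)] ends_subset[OF edge_in(5)] by (auto simp: ends_eqs)

lemma star_eqI:
  assumes "v \<in> verts G" "X \<subseteq> star G v" "card X = 3"
  shows "star G v = X"
  using card_subset_eq[OF finite_star assms(2)] card_star[OF assms(1)] assms(3) by simp

text \<open>Three distinct edges at a vertex are known, and a cubic vertex has no others.\<close>

lemma stars: "star G u2 = {ea, eb, g1}" "star G u3 = {ec, g1, g2}" "star G u4 = {ed, ee, g2}"
proof -
  show "star G u2 = {ea, eb, g1}" by (rule star_eqI) (use edges_distinct edge_in vert_in in \<open>auto simp: star_def ends_eqs\<close>)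
  show "star G u3 = {ec, g1, g2}" by (rule star_eqI) (use edges_distinct edge_in vert_in in \<open>auto simp: star_def ends_eqs\<close>)
  show "star G u4 = {ed, ee, g2}" by (rule star_eqI) (use edges_distinct edge_in vert_in in \<open>auto simp: star_def ends_eqs\<close>)
qed

text \<open>Hence deleting \<open>U\<close> removes precisely the seven named edges, and
  \<open>F\<close> survives as \<open>Old F\<close>.\<close>

lemma meets_U_iff: "f \<in> edges G \<Longrightarrow> ends G f \<inter> U \<noteq> {} \<longleftrightarrow> f \<in> {ea, eb, ec, ed, ee, g1, g2}"
  using stars by (auto simp: star_def ends_eqs)

lemma bij_old: "bij_betw old outer kept"
  unfolding bij_betw_def
proof
  show "inj_on old outer"
  proof (rule inj_onI)
    fix x y assume "x \<in> outer" "y \<in> outer" "old x = old y"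
    then show "x = y" using edges_distinct by (cases x; cases y) (auto simp: outer_def ends_eqs)
  qed
  have "{f \<in> edges G. ends G f \<inter> U = {}} = edges G - {ea, eb, ec, ed, ee, g1, g2}"
    using meets_U_iff by blast
  moreover have "old ` outer = {f \<in> edges G. ends G f \<inter> U = {}} \<union> leg ` ports"
    by (simp add: outer_def image_Un image_image)
  ultimately show "old ` outer = kept" using edges_distinct edge_in by (auto simp: kept_def)
qed

section \<open>Structure of the superposition\<close>

lemma edges_superposed: "edges superposed_graph = outer \<union> Gadget ` T_edges"
  by (auto simp: superposed_graph_def superposition_def outer_def)

lemma verts_superposed: "verts superposed_graph = Inl ` (verts G - U) \<union> range Inr"
  by (simp add: superposed_graph_def superposition_def)

lemma ends_superposed [simp]: "ends superposed_graph (Old f) = Inl ` ends G f" "ends superposed_graph (Gadget X) = Inr ` X"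
  "ends superposed_graph (Link t) = {Inl (link_end u1 u5 v2 v3 v4 t), Inr t}"
  by (simp_all add: superposed_graph_def superposition_def)

lemma ends_leg: "t \<in> ports \<Longrightarrow> w \<notin> U \<Longrightarrow> w \<in> ends G (leg t) \<longleftrightarrow> w = link_end u1 u5 v2 v3 v4 t"
  by (auto simp: ends_eqs link_end_def)

lemma link_end_in: "t \<in> ports \<Longrightarrow> link_end u1 u5 v2 v3 v4 t \<in> verts G - U"
  using path_neqs vert_in by (auto simp: link_end_def)

text \<open>Passing from a leg to its link changes only the end in \<open>U\<close>, so incidence at
  surviving vertices is unaffected.\<close>

lemma in_ends_superposed_iff: "y \<in> outer \<Longrightarrow> w \<notin> U \<Longrightarrow> Inl w \<in> ends superposed_graph y \<longleftrightarrow> w \<in> ends G (old y)"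
  unfolding outer_def using ends_leg by fastforce

lemma star_superposed_Inl: "w \<notin> U \<Longrightarrow> star superposed_graph (Inl w) = {y \<in> outer. w \<in> ends G (old y)}"
  using in_ends_superposed_iff by (auto simp: star_def edges_superposed)

lemma star_A: "w \<notin> U \<Longrightarrow> star G w = {x \<in> kept. w \<in> ends G x}"
  by (auto simp: star_def kept_def ends_eqs)

lemma old_star: "w \<notin> U \<Longrightarrow> old ` star superposed_graph (Inl w) = star G w"
  using bij_old by (auto simp: star_superposed_Inl star_A bij_betw_def)

lemma star_superposed_Inr:
  "star superposed_graph (Inr t) = Gadget ` {X \<in> T_edges. t \<in> X} \<union> (if t \<in> ports then {Link t} else {})"
  by (auto simp: star_def edges_superposed outer_def)

text \<open>Stars of surviving vertices are matched by \<open>old\<close> with those in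
  \<open>G\<close>; at a vertex of \<open>T\<close> the link, if there is one, raises the degree
  from 2 to 3.\<close>

lemma cubic_graph_superposed: "cubic_graph superposed_graph"
proof
  show "finite (verts superposed_graph)" using finite_verts by (simp add: verts_superposed)
  show "ends superposed_graph y \<subseteq> verts superposed_graph" "card (ends superposed_graph y) = 2" if y: "y \<in> edges superposed_graph" for y
  proof -
    consider f where "y = Old f" "f \<in> edges G" "ends G f \<inter> U = {}"
      | t where "y = Link t" "t \<in> ports" | X where "y = Gadget X" "X \<in> T_edges"
      using y by (auto simp: edges_superposed outer_def)
    then have "ends superposed_graph y \<subseteq> verts superposed_graph \<and> card (ends superposed_graph y) = 2"
    proof cases
      case 1
      then show ?thesis using ends_subset[of f] card_ends[of f]
        by (auto simp: verts_superposed card_image)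
    next
      case 2
      then show ?thesis using link_end_in[of t] by (simp add: verts_superposed)
    next
      case 3
      then show ?thesis using card_T_edge by (auto simp: verts_superposed card_image)
    qed
    then show "ends superposed_graph y \<subseteq> verts superposed_graph" "card (ends superposed_graph y) = 2" by auto
  qed
  show "inj_on (ends superposed_graph) (edges superposed_graph)"
  proof (rule inj_onI)
    fix x y assume xy: "x \<in> edges superposed_graph" "y \<in> edges superposed_graph" "ends superposed_graph x = ends superposed_graph y"
    have nonempty: "ends G f \<noteq> {}" if "f \<in> edges G" for f using card_ends[OF that] by auto
    have nonempty': "X \<noteq> {}" if "X \<in> T_edges" for X using card_T_edge[OF that] by auto
    \<comment> \<open>The parts of an end set in \<open>G\<close> and in \<open>T\<close> reveal the
      kind of edge: \<open>Old\<close> edges have no end in \<open>T\<close>, \<open>Gadget\<close>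
      edges none in \<open>G\<close>, and links have one in each.\<close>
    have "Inl -` ends superposed_graph x = Inl -` ends superposed_graph y" "Inr -` ends superposed_graph x = Inr -` ends superposed_graph y" using xy(3) by auto
    moreover have "Inl -` ends superposed_graph (Old f) = ends G f" "Inr -` ends superposed_graph (Old f) = {}"
      "Inl -` ends superposed_graph (Gadget X) = {}" "Inr -` ends superposed_graph (Gadget X) = X"
      "Inl -` ends superposed_graph (Link t) = {link_end u1 u5 v2 v3 v4 t}" "Inr -` ends superposed_graph (Link t) = {t}" for f X t
      by auto
    ultimately show "x = y"
      using xy(1,2)
      by (cases x; cases y) (auto simp: edges_superposed outer_def simp del: ends_superposed dest: ends_eqD nonempty nonempty')
  qed
  show "card (star superposed_graph v) = 3" if v: "v \<in> verts superposed_graph" for v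
  proof (cases v)
    case (Inl w)
    then have w: "w \<in> verts G" "w \<notin> U" using v by (auto simp: verts_superposed)
    have "inj_on old (star superposed_graph (Inl w))"
      using bij_old by (auto simp: star_superposed_Inl[OF w(2)] bij_betw_def intro: inj_on_subset)
    then have "card (star superposed_graph (Inl w)) = card (star G w)" using old_star[OF w(2)] by (metis card_image)
    then show ?thesis using card_star[OF w(1)] Inl by simp
  next
    case (Inr t)
    have "card (Gadget ` {X \<in> T_edges. t \<in> X} :: 'e sup_edge set) = card {X \<in> T_edges. t \<in> X}"
      by (rule card_image) (simp add: inj_on_def)
    then have "card (star superposed_graph (Inr t)) = card {X \<in> T_edges. t \<in> X} + (if t \<in> ports then 1 else 0)"
      unfolding star_superposed_Inr by (subst card_Un_disjoint) (auto simp: T_edges_def)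
    then show ?thesis by (simp add: Inr card_T_star)
  qed
qed

text \<open>The values on \<open>g1\<close> and \<open>g2\<close> are forced by the conditions at
  \<open>u2\<close> and \<open>u4\<close>. They are nonzero iff the two legs at each of these
  vertices differ, and the condition at \<open>u3\<close> then says that all five legs sum to
  0.\<close>

lemma card_inner_G:
  assumes \<phi>: "\<phi> ea \<noteq> 0" "\<phi> eb \<noteq> 0" "\<phi> ec \<noteq> 0" "\<phi> ed \<noteq> 0" "\<phi> ee \<noteq> 0"
  shows "card (inner_flows G kept (verts G - U) \<phi>) =
    (if \<phi> ea \<noteq> \<phi> eb \<and> \<phi> ed \<noteq> \<phi> ee \<and> \<phi> ea + \<phi> eb + \<phi> ec + \<phi> ed + \<phi> ee = 0 then 1 else 0)"
proof -
  let ?k = "\<phi> ea + \<phi> eb" and ?l = "\<phi> ed + \<phi> ee"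
  have diff: "edges G - kept = {g1, g2}" "verts G - (verts G - U) = U"
    using edge_in vert_in by (auto simp: kept_def)
  have stars_A: "star G u2 \<inter> kept = {ea, eb}" "star G u2 - kept = {g1}" "star G u3 \<inter> kept = {ec}"
    "star G u3 - kept = {g1, g2}" "star G u4 \<inter> kept = {ed, ee}" "star G u4 - kept = {g2}"
    using edge_in edges_distinct unfolding stars kept_def by auto
  have "inner_flows G kept (verts G - U) \<phi> = {\<tau> \<in> extensional {g1, g2}. \<tau> g1 \<noteq> 0 \<and> \<tau> g2 \<noteq> 0 \<and>
      ?k + \<tau> g1 = 0 \<and> \<phi> ec + (\<tau> g1 + \<tau> g2) = 0 \<and> ?l + \<tau> g2 = 0}"
    using edges_distinct unfolding inner_flows_def diff by (auto simp: stars_A)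
  also have "\<dots> = {\<tau> \<in> extensional {g1, g2}. \<tau> g1 = ?k \<and> \<tau> g2 = ?l \<and>
      ?k \<noteq> 0 \<and> ?l \<noteq> 0 \<and> \<phi> ec + (?k + ?l) = 0}"
    by (auto simp: klein_add_eq_0_iff)
  also have "\<dots> = (if \<phi> ea \<noteq> \<phi> eb \<and> \<phi> ed \<noteq> \<phi> ee \<and> \<phi> ea + \<phi> eb + \<phi> ec + \<phi> ed + \<phi> ee = 0
      then {(\<lambda>x. undefined)(g1 := ?k, g2 := ?l)} else {})"
    using edges_distinct
    by (auto simp: extensional_def fun_eq_iff klein_add_eq_0_iff[of "\<phi> ea"] klein_add_eq_0_iff[of "\<phi> ed"] ac_simps)
  finally show ?thesis by simp
qed

text \<open>The source of the factor 5: \<open>T\<close> can be filled under the same boundary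
  conditions as the path, in five ways instead of one.\<close>

lemma card_inner_superposed:
  assumes \<phi>: "\<phi> ea \<noteq> 0" "\<phi> eb \<noteq> 0" "\<phi> ec \<noteq> 0" "\<phi> ed \<noteq> 0" "\<phi> ee \<noteq> 0"
  shows "card (inner_flows superposed_graph outer (Inl ` (verts G - U)) (\<lambda>y\<in>outer. \<phi> (old y)))
    = 5 * card (inner_flows G kept (verts G - U) \<phi>)"
proof -
  let ?b = "boundary (\<phi> ea) (\<phi> eb) (\<phi> ec) (\<phi> ed) (\<phi> ee)"
  have diff: "edges superposed_graph - outer = Gadget ` T_edges" "verts superposed_graph - Inl ` (verts G - U) = range Inr"
    by (auto simp: edges_superposed verts_superposed outer_def)
  have star_split: "(Gadget ` T \<union> (if t \<in> P then {Link t} else {})) \<inter> outer = (if t \<in> P then {Link t} else {})"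
    "Gadget ` T \<union> (if t \<in> P then {Link t} else {}) - outer = Gadget ` T"
    if "\<And>t. t \<in> P \<Longrightarrow> Link t \<in> outer" for T P t
    using that by (auto simp: outer_def)
  have ports_B: "Link t \<in> outer" if "t \<in> ports" for t using that unfolding outer_def by blast
  have inside: "star superposed_graph (Inr t) \<inter> outer = (if t \<in> ports then {Link t} else {})"
    "star superposed_graph (Inr t) - outer = Gadget ` {X \<in> T_edges. t \<in> X}" for t
    unfolding star_superposed_Inr by (rule star_split(1), erule ports_B) (rule star_split(2), erule ports_B)
  have gadget_star: "Gadget ` {X \<in> T_edges. t \<in> X} = {y \<in> Gadget ` T_edges. t \<in> gadget_ends y}" for t
    by (auto simp: gadget_ends_def)
  have bd: "sum (\<lambda>y\<in>outer. \<phi> (old y)) (star superposed_graph (Inr t) \<inter> outer) = ?b t" for t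
    unfolding inside by (cases t) (simp_all add: boundary_def outer_def)
  have "inner_flows superposed_graph outer (Inl ` (verts G - U)) (\<lambda>y\<in>outer. \<phi> (old y))
      = solutions gadget_ends (Gadget ` T_edges) ?b"
    by (simp only: inner_flows_def solutions_def diff ball_simps ball_UNIV bd inside(2) gadget_star)
  then show ?thesis using card_gadget_solutions[OF \<phi>, where ?'e = 'e] card_inner_G[OF \<phi>] by simp
qed

text \<open>Both flow counts are split along their cuts; the outer flows are matched through
  \<open>old\<close>, and the inner counts are compared term by term.\<close>

lemma card_flows_superposed: "card (flows superposed_graph (Old F)) = 5 * card (flows G F)"
proof -
  interpret superposed_graph: cubic_graph superposed_graph by (rule cubic_graph_superposed)
  let ?V = "verts G - U" and ?W = "Inl ` (verts G - U) :: ('v + tvert) set"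
  have FA: "F \<in> kept" "Old F \<in> outer" using F meets_U_iff[OF F(1)] by (auto simp: kept_def outer_def)
  have star_V: "star G v \<subseteq> kept" if "v \<in> ?V" for v using that star_A by auto
  have star_W: "star superposed_graph w \<subseteq> outer" if "w \<in> ?W" for w using that star_superposed_Inl by auto
  have "card (flows superposed_graph (Old F)) = (\<Sum>\<psi>\<in>outer_flows superposed_graph (Old F) outer ?W. card (inner_flows superposed_graph outer ?W \<psi>))"
    by (rule card_flows_split[OF superposed_graph.finite_edges]) (use FA star_W in \<open>auto simp: edges_superposed verts_superposed\<close>)
  also have "\<dots> = (\<Sum>\<phi>\<in>outer_flows G F kept ?V. card (inner_flows superposed_graph outer ?W (\<lambda>y\<in>outer. \<phi> (old y))))"
    by (rule sum.reindex_bij_betw[symmetric], rule bij_betw_outer_flows[OF bij_old, where n = Inl])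
      (use FA star_V star_W old_star in auto)
  also have "\<dots> = (\<Sum>\<phi>\<in>outer_flows G F kept ?V. 5 * card (inner_flows G kept ?V \<phi>))"
  proof (rule sum.cong[OF HOL.refl])
    \<comment> \<open>\<open>F\<close> is none of the legs, so the values on the cut are nonzero, as
      the inner counts require.\<close>
    fix \<phi> assume "\<phi> \<in> outer_flows G F kept ?V"
    then have "\<phi> x \<noteq> 0" if "x \<in> {ea, eb, ec, ed, ee}" for x
      using that edge_in edges_distinct F by (auto simp: outer_flows_def kept_def)
    then show "card (inner_flows superposed_graph outer ?W (\<lambda>y\<in>outer. \<phi> (old y))) = 5 * card (inner_flows G kept ?V \<phi>)"
      by (intro card_inner_superposed) auto
  qed
  also have "\<dots> = 5 * card (flows G F)"
    unfolding sum_distrib_left[symmetric]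
    by (subst card_flows_split[OF finite_edges, of kept F ?V]) (use FA star_V in \<open>auto simp: kept_def\<close>)
  finally show ?thesis .
qed

text \<open>For the superposition \<open>psi\<close> is read off by \<open>psi_eq\<close>, since its
  flow count is exhibited as a multiple of 18.\<close>

lemma psi_superposed:
  assumes "\<not> edge_colourable3 G"
  shows "psi superposed_graph (Old F) = 5 * psi G F"
proof -
  interpret superposed_graph: cubic_graph superposed_graph by (rule cubic_graph_superposed)
  have "Old F \<in> edges superposed_graph" using F meets_U_iff[OF F(1)] by (auto simp: edges_superposed outer_def)
  moreover have "card (flows superposed_graph (Old F)) = 18 * (5 * psi G F)"
    using card_flows_superposed psi_eq_flows[OF F(1) assms] by simp
  ultimately show ?thesis by (rule superposed_graph.psi_eq)
qed

end

theorem theorem5p3: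
  fixes G\<^sub>0 :: "('v, 'e) ugraph"
    and u1 u2 u3 u4 u5 v2 v3 v4 :: 'v
    and F :: 'e
  assumes "snark G\<^sub>0"
    and "{u1, u2, u3, u4, u5} \<subseteq> verts G\<^sub>0"
    and "distinct [u1, u2, u3, u4, u5]"
    and "joined G\<^sub>0 u1 u2" and "joined G\<^sub>0 u2 u3" and "joined G\<^sub>0 u3 u4" and "joined G\<^sub>0 u4 u5"
    and "{v2, v3, v4} \<subseteq> verts G\<^sub>0"
    and "{v2, v3, v4} \<inter> {u1, u2, u3, u4, u5} = {}"
    and "joined G\<^sub>0 u2 v2" and "joined G\<^sub>0 u3 v3" and "joined G\<^sub>0 u4 v4"
    and "F \<in> edges G\<^sub>0"
    and "ends G\<^sub>0 F \<notin> {{u1, u2}, {u2, u3}, {u3, u4}, {u4, u5}, {u2, v2}, {u3, v3}, {u4, v4}}"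
  shows "psi (superposition G\<^sub>0 u1 u2 u3 u4 u5 v2 v3 v4) (Old F) = 5 * psi G\<^sub>0 F"
proof -
  obtain ea where ea: "ea \<in> edges G\<^sub>0" "ends G\<^sub>0 ea = {u1, u2}" using assms(4) by (auto simp: joined_def)
  obtain g1 where g1: "g1 \<in> edges G\<^sub>0" "ends G\<^sub>0 g1 = {u2, u3}" using assms(5) by (auto simp: joined_def)
  obtain g2 where g2: "g2 \<in> edges G\<^sub>0" "ends G\<^sub>0 g2 = {u3, u4}" using assms(6) by (auto simp: joined_def)
  obtain ee where ee: "ee \<in> edges G\<^sub>0" "ends G\<^sub>0 ee = {u4, u5}" using assms(7) by (auto simp: joined_def)
  obtain eb where eb: "eb \<in> edges G\<^sub>0" "ends G\<^sub>0 eb = {u2, v2}" using assms(10) by (auto simp: joined_def)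
  obtain ec where ec: "ec \<in> edges G\<^sub>0" "ends G\<^sub>0 ec = {u3, v3}" using assms(11) by (auto simp: joined_def)
  obtain ed where ed: "ed \<in> edges G\<^sub>0" "ends G\<^sub>0 ed = {u4, v4}" using assms(12) by (auto simp: joined_def)
  interpret cubic_graph G\<^sub>0 by (rule snark_cubic_graph[OF assms(1)])
  interpret superposed G\<^sub>0 u1 u2 u3 u4 u5 v2 v3 v4 ea eb ec ed ee g1 g2 F
  proof
    show "{ea, eb, ec, ed, ee, g1, g2} \<subseteq> edges G\<^sub>0" using ea eb ec ed ee g1 g2 by simp
    show "F \<notin> {ea, eb, ec, ed, ee, g1, g2}" 
      \<comment> \<open>Folding the end sets back into \<open>ends\<close> of the chosen edges turns
        the condition on the ends of \<open>F\<close> into its being none of these edges.\<close>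
      using assms(14)[folded ea(2) eb(2) ec(2) ed(2) ee(2) g1(2) g2(2)] by blast
  qed (use ea eb ec ed ee g1 g2 assms(3,9,13) in simp_all)
  show ?thesis using psi_superposed assms(1) by (simp add: superposed_graph_def snark_def)
qed

end
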